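(* Let $n\ge 3$ and $1\le l\le n$ be integers, and let $\mathcal{F}$ be a union-$l$-intersecting set system whose elements are subsets of $[n]$. Then the following upper bounds hold. (a) If $n+l$ is even, then $$|\mathcal{F}|\le \sum_{i=\frac{n+l}{2}-1}^{n}\binom{n}{i}.$$ (b) If $n+l$ is odd, then $$|\mathcal{F}|\le AK\left(n,\tfrac{n+l-3}{2},l\right)+\sum_{i=\frac{n+l-1}{2}}^{n}\binom{n}{i}.$$ These bounds are best possible: for all such $n$ and $l$ there is a union-$l$-intersecting system of subsets of $[n]$ for which equality holds in the corresponding bound.
   Context: $[n]=\{1,2,\dots,n\}$, and $\binom{[n]}{k}$ denotes the set of all $k$-element subsets of $[n]$. A set system is a family of distinct sets. A set system $\mathcal{F}$ is called union-$l$-intersecting if $|(F_1\cup F_2)\cap(G_1\cup G_2)|\ge l$ for all $F_1,F_2,G_1,G_2\in\mathcal{F}$ with $F_1\ne F_2$ and $G_1\ne G_2$ (no other distinctness is required; for instance $F_1=G_1$ is allowed). For integers $n,k,l$ with $1\le l\le n$ and $1\le k\le n$, put $$\mathcal{F}_i=\left\{F\in\binom{[n]}{k} : |F\cap[l+2i]|\ge l+i\right\}\qquad \left(i \text{ an integer},\ 0\le i\le \tfrac{n-l}{2}\right)$$ and $$AK(n,k,l)=\max_{0\le i\le \frac{n-l}{2}}|\mathcal{F}_i|.$$ In particular $AK(n,k,l)=0$ when $k<l$. *)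

theory Defs
  imports Complex_Main
begin

definition union_intersecting :: "nat \<Rightarrow> nat set set \<Rightarrow> bool" where
  "union_intersecting l \<F> \<longleftrightarrow>
     (\<forall>F1\<in>\<F>. \<forall>F2\<in>\<F>. \<forall>G1\<in>\<F>. \<forall>G2\<in>\<F>.
        F1 \<noteq> F2 \<longrightarrow> G1 \<noteq> G2 \<longrightarrow> l \<le> card ((F1 \<union> F2) \<inter> (G1 \<union> G2)))"

definition AK_family :: "nat \<Rightarrow> nat \<Rightarrow> nat \<Rightarrow> nat \<Rightarrow> nat set set" where
  "AK_family n k l i =
     {F. F \<subseteq> {1..n} \<and> card F = k \<and> l + i \<le> card (F \<inter> {1..l + 2 * i})}"

text \<open>Meant for \<open>1 \<le> l \<le> n\<close>; then \<open>i \<le> (n - l) div 2\<close> says exactly \<open>l + 2 * i \<le> n\<close>.\<close>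

definition AK :: "nat \<Rightarrow> nat \<Rightarrow> nat \<Rightarrow> nat" where
  "AK n k l = Max ((\<lambda>i. card (AK_family n k l i)) ` {0..(n - l) div 2})"

end

theory Submission imports Defs begin

text \<open>
  Enlarging a member to a non-member preserves union-intersection, so \<open>\<F>\<close> may be taken to be an
  up-set. Then its non-minimal members are pairwise \<open>l\<close>-intersecting, the members of a fixed size \<open>i\<close>
  are \<open>l\<close>-intersecting if \<open>2 * i + 3 \<le> n + l\<close>, and members of size \<open>i\<close> meet non-minimal members of
  size \<open>j\<close> in \<open>l\<close> points if \<open>i + j + 2 = n + l\<close>. A shadow argument in the style of Katona shows that
  level \<open>i\<close> together with the non-minimal sets in level \<open>j\<close> has at most \<open>n choose j\<close> elements. What
  remains above the middle level \<open>q\<close> are the minimal members and the non-minimal ones of size \<open>q\<close>: an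
  antichain, of size at most \<open>n choose q\<close>. If \<open>n + l\<close> is odd, level \<open>q - 1\<close> is left unpaired; it is
  \<open>l\<close>-intersecting, and bounded by the complete intersection theorem of Ahlswede and Khachatrian for
  \<open>n + l = 2 * k + 3\<close>.

  That theorem is proved by the method of generating sets. If a left-compressed optimal family is
  determined by the first \<open>m\<close> points and \<open>m\<close> is minimal, exchanging members for which the point \<open>m\<close>
  is essential shows that \<open>m = t + 2 * r\<close> with \<open>r\<close> bounded. The same holds for the reversed
  complements, with some \<open>m'\<close>, and the two bounds give \<open>m + m' \<le> n\<close>. Membership of \<open>A\<close> is then
  decided by \<open>card (A \<inter> {1..m})\<close> alone, so the family lies in one of the Ahlswede-Khachatrian families.
\<close>


section \<open>Uniform families, cross-intersection and shadows\<close>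

definition ksets :: "nat \<Rightarrow> nat \<Rightarrow> nat set set" where
  "ksets n k = {A. A \<subseteq> {1..n} \<and> card A = k}"

definition cross_intersecting :: "nat \<Rightarrow> nat set set \<Rightarrow> nat set set \<Rightarrow> bool" where
  "cross_intersecting t F H \<longleftrightarrow> (\<forall>A\<in>F. \<forall>B\<in>H. t \<le> card (A \<inter> B))"

abbreviation intersecting :: "nat \<Rightarrow> nat set set \<Rightarrow> bool" where
  "intersecting t F \<equiv> cross_intersecting t F F"

definition shadow :: "nat \<Rightarrow> nat set set \<Rightarrow> nat set set" where
  "shadow k F = {B. card B = k \<and> (\<exists>A\<in>F. B \<subseteq> A)}"

lemma finite_ksets [simp]: "finite (ksets n k)"
  unfolding ksets_def by (rule finite_subset[of _ "Pow {1..n}"]) auto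

lemma card_ksets: "card (ksets n k) = n choose k"
  unfolding ksets_def using n_subsets[of "{1..n}" k] by simp

lemma ksetsD: "A \<in> ksets n k \<Longrightarrow> A \<subseteq> {1..n}" "A \<in> ksets n k \<Longrightarrow> card A = k"
  "A \<in> ksets n k \<Longrightarrow> finite A"
  unfolding ksets_def by (blast, blast, blast intro: finite_subset[OF _ finite_atLeastAtMost])

lemma ksetsI: "A \<subseteq> {1..n} \<Longrightarrow> card A = k \<Longrightarrow> A \<in> ksets n k"
  by (simp add: ksets_def)

lemma cross_intersectingD:
  "cross_intersecting t F H \<Longrightarrow> A \<in> F \<Longrightarrow> B \<in> H \<Longrightarrow> t \<le> card (A \<inter> B)"
  by (simp add: cross_intersecting_def)

lemma shadow_subset_ksets: "F \<subseteq> ksets n k \<Longrightarrow> shadow j F \<subseteq> ksets n j"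
  unfolding shadow_def ksets_def by auto

lemma card_supersets:
  assumes "B \<in> ksets n j"
  shows "card {A \<in> ksets n (j + u). B \<subseteq> A} = (n - j) choose u"
proof -
  have B: "B \<subseteq> {1..n}" "card B = j" "finite B" by (fact ksetsD[OF assms])+
  have "bij_betw (\<lambda>C. C \<union> B) {C. C \<subseteq> {1..n} - B \<and> card C = u} {A \<in> ksets n (j + u). B \<subseteq> A}"
  proof (rule bij_betw_byWitness[where f' = "\<lambda>A. A - B"])
    show "(\<lambda>C. C \<union> B) ` {C. C \<subseteq> {1..n} - B \<and> card C = u} \<subseteq> {A \<in> ksets n (j + u). B \<subseteq> A}"
    proof
      fix A assume "A \<in> (\<lambda>C. C \<union> B) ` {C. C \<subseteq> {1..n} - B \<and> card C = u}"
      then obtain C where C: "C \<subseteq> {1..n} - B" "card C = u" "A = C \<union> B" by blast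
      have "finite C" by (rule finite_subset[OF C(1)]) simp
      moreover have "C \<inter> B = {}" using C(1) by blast
      ultimately have "card A = j + u" using card_Un_disjoint[of C B] C(2,3) B(2,3) by simp
      moreover have "A \<subseteq> {1..n}" "B \<subseteq> A" using C(1,3) B(1) by blast+
      ultimately show "A \<in> {A \<in> ksets n (j + u). B \<subseteq> A}" by (simp add: ksetsI)
    qed
    show "(\<lambda>A. A - B) ` {A \<in> ksets n (j + u). B \<subseteq> A} \<subseteq> {C. C \<subseteq> {1..n} - B \<and> card C = u}"
    proof
      fix C assume "C \<in> (\<lambda>A. A - B) ` {A \<in> ksets n (j + u). B \<subseteq> A}"
      then obtain A where A: "A \<in> ksets n (j + u)" "B \<subseteq> A" "C = A - B" by blast
      have "C \<subseteq> {1..n} - B" using ksetsD(1)[OF A(1)] A(3) by blast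
      moreover have "card C = u"
        using card_Diff_subset[OF B(3) A(2)] ksetsD(2)[OF A(1)] A(3) B(2) by simp
      ultimately show "C \<in> {C. C \<subseteq> {1..n} - B \<and> card C = u}" by simp
    qed
  qed blast+
  then have "card {A \<in> ksets n (j + u). B \<subseteq> A} = card {C. C \<subseteq> {1..n} - B \<and> card C = u}"
    by (rule bij_betw_same_card[symmetric])
  also have "\<dots> = card ({1..n} - B) choose u" by (rule n_subsets) simp
  also have "card ({1..n} - B) = n - j" using B by (simp add: card_Diff_subset)
  finally show ?thesis .
qed

text \<open>Double counting of the pairs \<open>B \<subseteq> A\<close> with \<open>A\<close> in
  \<open>F\<close> and \<open>B\<close> in the shadow: every \<open>A\<close> contains
  \<open>(j + u) choose u\<close> sets of size \<open>j\<close>, all of them in the shadow, and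
  every \<open>B\<close> lies in at most \<open>(n - j) choose u\<close> members.\<close>

lemma card_shadow_mult:
  assumes "F \<subseteq> ksets n (j + u)"
  shows "card F * ((j + u) choose u) \<le> card (shadow j F) * ((n - j) choose u)"
proof -
  have fin: "finite F" "finite (shadow j F)"
    by (fact finite_subset[OF assms finite_ksets]
        finite_subset[OF shadow_subset_ksets[OF assms] finite_ksets])+
  have "(\<Sum>B\<in>shadow j F. card {A \<in> F. B \<subseteq> A}) = ((j + u) choose u) * card F"
  proof (rule sum_multicount[OF fin(2,1)])
    show "\<forall>A\<in>F. card {B \<in> shadow j F. B \<subseteq> A} = ((j + u) choose u)"
    proof
      fix A assume A: "A \<in> F"
      have "{B \<in> shadow j F. B \<subseteq> A} = {B. B \<subseteq> A \<and> card B = j}"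
        using A by (auto simp: shadow_def)
      moreover have "card A = j + u" "finite A" using A assms by (auto dest: ksetsD)
      ultimately show "card {B \<in> shadow j F. B \<subseteq> A} = ((j + u) choose u)"
        using n_subsets[of A j] binomial_symmetric[of j "j + u"] by simp
    qed
  qed
  moreover have "(\<Sum>B\<in>shadow j F. card {A \<in> F. B \<subseteq> A}) \<le> (\<Sum>B\<in>shadow j F. (n - j) choose u)"
  proof (rule sum_mono)
    fix B assume "B \<in> shadow j F"
    then have "B \<in> ksets n j" using shadow_subset_ksets[OF assms] by auto
    then have "card {A \<in> ksets n (j + u). B \<subseteq> A} = (n - j) choose u" by (rule card_supersets)
    moreover have "card {A \<in> F. B \<subseteq> A} \<le> card {A \<in> ksets n (j + u). B \<subseteq> A}"
      using assms by (intro card_mono) auto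
    ultimately show "card {A \<in> F. B \<subseteq> A} \<le> (n - j) choose u" by simp
  qed
  ultimately show ?thesis by (simp add: mult.commute)
qed

text \<open>Since \<open>n - j \<le> j + u\<close>, the factor on the shadow side of the double
  count is at most the one on the side of \<open>F\<close>, and it cancels.\<close>

lemma card_le_card_shadow:
  assumes "F \<subseteq> ksets n (j + u)" "n \<le> 2 * j + u"
  shows "card F \<le> card (shadow j F)"
proof -
  have "card (shadow j F) * ((n - j) choose u) \<le> card (shadow j F) * ((j + u) choose u)"
    using assms(2) by (intro mult_left_mono binomial_right_mono) auto
  with card_shadow_mult[OF assms(1)]
  have "card F * ((j + u) choose u) \<le> card (shadow j F) * ((j + u) choose u)" by linarith
  then show ?thesis by simp
qed

subsection \<open>Left compression\<close>

definition swap :: "nat \<Rightarrow> nat \<Rightarrow> nat set \<Rightarrow> nat set" where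
  "swap i j A = (if j \<in> A \<and> i \<notin> A then insert i (A - {j}) else A)"

definition shift :: "nat \<Rightarrow> nat \<Rightarrow> nat set set \<Rightarrow> nat set set" where
  "shift i j F = (\<lambda>A. if swap i j A \<in> F then A else swap i j A) ` F"

definition left_compressed :: "nat set set \<Rightarrow> bool" where
  "left_compressed F \<longleftrightarrow>
     (\<forall>A\<in>F. \<forall>i j. 1 \<le> i \<longrightarrow> i < j \<longrightarrow> j \<in> A \<longrightarrow> i \<notin> A \<longrightarrow> insert i (A - {j}) \<in> F)"

lemma left_compressedD:
  "left_compressed F \<Longrightarrow> A \<in> F \<Longrightarrow> 1 \<le> i \<Longrightarrow> i < j \<Longrightarrow> j \<in> A \<Longrightarrow> i \<notin> A \<Longrightarrow>
    insert i (A - {j}) \<in> F"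
  by (simp add: left_compressed_def)

lemma insert_remove_ksets:
  assumes "A \<in> ksets n k" "j \<in> A" "i \<notin> A" "1 \<le> i" "i \<le> n"
  shows "insert i (A - {j}) \<in> ksets n k"
proof -
  have "finite A" "card A = k" "A \<subseteq> {1..n}" by (fact ksetsD[OF assms(1)])+
  moreover have "card A \<noteq> 0" using calculation(1) assms(2) by (subst card_0_eq) auto
  ultimately show ?thesis using assms by (auto simp: ksets_def card_Diff_singleton)
qed

text \<open>A member that stays put has its swapped version in \<open>F\<close> as well; recording
  this is what makes the intersection argument for shifted families work.\<close>

lemma shift_cases:
  assumes "A \<in> shift i j F"
  obtains (kept) "A \<in> F" "swap i j A \<in> F"
  | (moved) B where "B \<in> F" "j \<in> B" "i \<notin> B" "A = insert i (B - {j})" "A \<notin> F"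
proof -
  from assms obtain B where B: "B \<in> F" "A = (if swap i j B \<in> F then B else swap i j B)"
    by (auto simp: shift_def)
  show thesis
  proof (cases "swap i j B \<in> F")
    case True then show thesis using B kept by auto
  next
    case False
    then have "swap i j B \<noteq> B" using B by auto
    then have "j \<in> B" "i \<notin> B" by (auto simp: swap_def split: if_splits)
    then show thesis using moved[of B] B False by (auto simp: swap_def)
  qed
qed

lemma card_shift: "card (shift i j F) = card F"
proof -
  have "inj_on (\<lambda>A. if swap i j A \<in> F then A else swap i j A) F"
  proof (rule inj_onI)
    fix A B assume *: "A \<in> F" "B \<in> F"
      "(if swap i j A \<in> F then A else swap i j A) = (if swap i j B \<in> F then B else swap i j B)"
    show "A = B"
    proof (cases "swap i j A \<in> F \<or> swap i j B \<in> F")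
      case True then show ?thesis using * by (auto split: if_splits)
    next
      case False
      then have e: "swap i j A = swap i j B" using * by auto
      have "swap i j A \<noteq> A" "swap i j B \<noteq> B" using False * by auto
      then have "j \<in> A \<and> i \<notin> A" "j \<in> B \<and> i \<notin> B" by (auto simp: swap_def split: if_splits)
      with e have "insert i (A - {j}) = insert i (B - {j})" by (simp add: swap_def)
      then have "insert j (insert i (A - {j}) - {i}) = insert j (insert i (B - {j}) - {i})" by simp
      moreover have "insert j (insert i (C - {j}) - {i}) = C" if "j \<in> C \<and> i \<notin> C" for C
        using that by blast
      ultimately show ?thesis
        using \<open>j \<in> A \<and> i \<notin> A\<close> \<open>j \<in> B \<and> i \<notin> B\<close> by metis
    qed
  qed
  then show ?thesis unfolding shift_def by (rule card_image)
qed

lemma shift_subset_ksets: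
  assumes "F \<subseteq> ksets n k" "1 \<le> i" "i \<le> n"
  shows "shift i j F \<subseteq> ksets n k"
proof
  fix A assume "A \<in> shift i j F"
  then show "A \<in> ksets n k"
    by (cases rule: shift_cases) (use assms insert_remove_ksets in auto)
qed

lemma cross_intersecting_sym: "cross_intersecting t F H \<Longrightarrow> cross_intersecting t H F"
unfolding cross_intersecting_def by (subst (asm) Int_commute) blast

text \<open>Two moved sets both trade \<open>j\<close> for \<open>i\<close>, so their intersection
  keeps its size. The critical pair is a moved set against a kept \<open>B\<close> with
  \<open>j \<in> B\<close> and \<open>i \<notin> B\<close>: then the swapped version of
  \<open>B\<close> is available, and it meets the original set in the same points as
  \<open>B\<close> meets the moved one.\<close>

lemma cross_intersecting_shift:
  assumes x: "cross_intersecting t F H" and fin: "\<And>A. A \<in> F \<Longrightarrow> finite A" "\<And>A. A \<in> H \<Longrightarrow> finite A"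
  shows "cross_intersecting t (shift i j F) (shift i j H)"
proof -
  have mixed: "t \<le> card (insert i (A - {j}) \<inter> B)"
    if x: "cross_intersecting t F H" and fin: "finite A"
      and A: "A \<in> F" "j \<in> A" "i \<notin> A" and B: "B \<in> H" "swap i j B \<in> H" for F H A B
  proof (cases "j \<in> B \<and> i \<notin> B")
    case True
    then have "insert i (A - {j}) \<inter> B = A \<inter> insert i (B - {j})" using A by auto
    moreover have "insert i (B - {j}) \<in> H" using B True by (simp add: swap_def)
    ultimately show ?thesis using cross_intersectingD[OF x A(1)] by simp
  next
    case False
    show ?thesis
    proof (cases "j \<in> B")
      case True
      then have "insert i (A - {j}) \<inter> B = insert i (A \<inter> B - {j})" using False by auto
      moreover have "card (insert i (A \<inter> B - {j})) = card (A \<inter> B)"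
        using card_Suc_Diff1[of "A \<inter> B" j] A True fin by simp
      ultimately show ?thesis using cross_intersectingD[OF x A(1) B(1)] by simp
    next
      case False
      then have "A \<inter> B \<subseteq> insert i (A - {j}) \<inter> B" by auto
      then have "card (A \<inter> B) \<le> card (insert i (A - {j}) \<inter> B)" using fin by (intro card_mono) auto
      then show ?thesis using cross_intersectingD[OF x A(1) B(1)] by simp
    qed
  qed
  show ?thesis
    unfolding cross_intersecting_def
  proof (intro ballI)
    fix A B assume "A \<in> shift i j F" "B \<in> shift i j H"
    then show "t \<le> card (A \<inter> B)"
    proof (cases rule: shift_cases[case_product shift_cases])
      case kept_kept then show ?thesis using cross_intersectingD[OF x] by blast
    next
      case (kept_moved B')
      then show ?thesis using mixed[OF cross_intersecting_sym[OF x], of B' A] fin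
        by (simp add: Int_commute)
    next
      case (moved_kept A')
      then show ?thesis using mixed[OF x, of A' B] fin by simp
    next
      case (moved_moved A' B')
      then have "A \<inter> B = insert i (A' \<inter> B' - {j})" by auto
      moreover have "card (insert i (A' \<inter> B' - {j})) = card (A' \<inter> B')"
        using card_Suc_Diff1[of "A' \<inter> B'" j] moved_moved fin by simp
      ultimately show ?thesis using cross_intersectingD[OF x] moved_moved by simp
    qed
  qed
qed

text \<open>The termination measure of compression: trading \<open>j\<close> for a smaller
  \<open>i\<close> lowers the element sum of at least the set \<open>A\<close> and raises
  none.\<close>

lemma sum_shift_less:
  assumes F: "F \<subseteq> ksets n k" and "A \<in> F" "i < j" "j \<in> A" "i \<notin> A" "insert i (A - {j}) \<notin> F"
  shows "(\<Sum>B\<in>shift i j F. \<Sum>B) < (\<Sum>B\<in>F. \<Sum>B)"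
proof -
  let ?f = "\<lambda>A. if swap i j A \<in> F then A else swap i j A"
  have inj: "inj_on ?f F"
    using card_shift[of i j F] F finite_subset[OF F] unfolding shift_def
    by (intro eq_card_imp_inj_on) auto
  have le: "\<Sum>(swap i j B) \<le> \<Sum>B" "j \<in> B \<Longrightarrow> i \<notin> B \<Longrightarrow> \<Sum>(swap i j B) < \<Sum>B" if "B \<in> F" for B
  proof -
    have fB: "finite B" using that F by (auto dest: ksetsD)
    show l: "\<Sum>(swap i j B) < \<Sum>B" if "j \<in> B" "i \<notin> B"
    proof -
      have "\<Sum>(swap i j B) = i + \<Sum>(B - {j})" using that fB by (simp add: swap_def)
      moreover have "\<Sum>B = j + \<Sum>(B - {j})" using that fB by (simp add: sum.remove)
      ultimately show ?thesis using \<open>i < j\<close> by simp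
    qed
    then show "\<Sum>(swap i j B) \<le> \<Sum>B" by (cases "j \<in> B \<and> i \<notin> B") (auto simp: swap_def)
  qed
  have "(\<Sum>B\<in>shift i j F. \<Sum>B) = (\<Sum>B\<in>F. \<Sum>(?f B))"
    unfolding shift_def sum.reindex[OF inj] by (simp only: comp_def)
  also have "\<dots> < (\<Sum>B\<in>F. \<Sum>B)"
  proof (rule sum_strict_mono_ex1)
    show "finite F" using F by (rule finite_subset) simp
    show "\<forall>B\<in>F. \<Sum>(?f B) \<le> \<Sum>B" using le by auto
    have "swap i j A = insert i (A - {j})" using assms by (simp add: swap_def)
    then have "\<Sum>(?f A) < \<Sum>A" using le(2)[of A] assms by simp
    then show "\<exists>B\<in>F. \<Sum>(?f B) < \<Sum>B" using assms by blast
  qed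
  finally show ?thesis .
qed

text \<open>Both families undergo the same shifts, so cross-intersection survives, but the shifts
  are chosen for \<open>F\<close> alone; nothing is claimed about compression of
  \<open>H'\<close>.\<close>

lemma exists_left_compressed:
  assumes "F \<subseteq> ksets n a" "H \<subseteq> ksets n b" "intersecting t F" "cross_intersecting s F H"
  obtains F' H' where "F' \<subseteq> ksets n a" "H' \<subseteq> ksets n b" "intersecting t F'"
    "cross_intersecting s F' H'" "left_compressed F'" "card F' = card F" "card H' = card H"
proof -
  have "\<exists>F' H'. F' \<subseteq> ksets n a \<and> H' \<subseteq> ksets n b \<and> intersecting t F' \<and>
    cross_intersecting s F' H' \<and> left_compressed F' \<and> card F' = card F \<and> card H' = card H"
    using assms
  proof (induction "\<Sum>B\<in>F. \<Sum>B" arbitrary: F H rule: less_induct)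
    case less
    show ?case
    proof (cases "left_compressed F")
      case True then show ?thesis using less.prems by blast
    next
      case False
      then obtain A i j where A: "A \<in> F" "1 \<le> i" "i < j" "j \<in> A" "i \<notin> A" "insert i (A - {j}) \<notin> F"
        unfolding left_compressed_def by blast
      have "j \<le> n" using ksetsD(1)[of A n a] A(1,4) less.prems(1) by (metis atLeastAtMost_iff subsetD)
      then have i: "1 \<le> i" "i \<le> n" using A by auto
      have fin: "\<And>A. A \<in> F \<Longrightarrow> finite A" "\<And>A. A \<in> H \<Longrightarrow> finite A"
        by (meson ksetsD(3) less.prems(1,2) subsetD)+
      note * = less.hyps[OF sum_shift_less[OF less.prems(1) A(1,3-6)]
          shift_subset_ksets[OF less.prems(1) i] shift_subset_ksets[OF less.prems(2) i, of j]
          cross_intersecting_shift[OF less.prems(3) fin(1) fin(1)]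
          cross_intersecting_shift[OF less.prems(4) fin]]
      show ?thesis using *[unfolded card_shift] .
    qed
  qed
  then show thesis using that by metis
qed


subsection \<open>A cross-intersection bound\<close>

lemma split_last:
  assumes "F \<subseteq> ksets (Suc m) k" "1 \<le> k"
  defines "F0 \<equiv> {A \<in> F. Suc m \<notin> A}" and "F1 \<equiv> (\<lambda>A. A - {Suc m}) ` {A \<in> F. Suc m \<in> A}"
  shows "F0 \<subseteq> ksets m k" "F1 \<subseteq> ksets m (k - 1)" "card F = card F0 + card F1"
proof -
  have *: "x \<in> {1..m}" if "A \<in> F" "x \<in> A" "x \<noteq> Suc m" for A x
  proof -
    have "x \<in> {1..Suc m}" using that assms(1) ksetsD(1) by blast
    with that(3) show ?thesis by auto
  qed
  show "F0 \<subseteq> ksets m k"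
  proof
    fix A assume "A \<in> F0"
    then have "A \<in> F" "Suc m \<notin> A" by (auto simp: F0_def)
    then have "A \<subseteq> {1..m}" "card A = k" using * assms(1) ksetsD(2) by blast+
    then show "A \<in> ksets m k" by (rule ksetsI)
  qed
  show "F1 \<subseteq> ksets m (k - 1)"
  proof
    fix B assume "B \<in> F1"
    then obtain A where A: "A \<in> F" "Suc m \<in> A" "B = A - {Suc m}" by (auto simp: F1_def)
    have "finite A" "card A = k" using A assms(1) ksetsD by blast+
    then show "B \<in> ksets m (k - 1)" using A * by (intro ksetsI) auto
  qed
  have "finite F" using assms(1) by (rule finite_subset) simp
  have "inj_on (\<lambda>A. A - {Suc m}) {A \<in> F. Suc m \<in> A}" by (rule inj_onI) blast
  then have "card F1 = card {A \<in> F. Suc m \<in> A}" unfolding F1_def by (rule card_image)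
  moreover have "card F = card (F0 \<union> {A \<in> F. Suc m \<in> A})"
    by (rule arg_cong[where f = card]) (auto simp: F0_def)
  moreover have "card (F0 \<union> {A \<in> F. Suc m \<in> A}) = card F0 + card {A \<in> F. Suc m \<in> A}"
    by (rule card_Un_disjoint) (use \<open>finite F\<close> in \<open>auto simp: F0_def\<close>)
  ultimately show "card F = card F0 + card F1" by simp
qed

lemma complement_in_ksets:
  "A \<in> ksets n k \<Longrightarrow> {1..n} - A \<in> ksets n (n - k)"
  by (auto simp: ksets_def card_Diff_subset finite_subset)

lemma card_complements:
  assumes "H \<subseteq> Pow {1..n}" shows "card ((\<lambda>B. {1..n} - B) ` H) = card H"
  by (rule card_image, rule inj_onI) (use assms in blast)

lemma card_Int_complement:
  assumes "A \<in> ksets n i" "B \<in> ksets n j"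
  shows "card (A \<inter> B) + card (A \<union> B) = i + j" "card (A \<union> B) \<le> n"
proof -
  have "finite A" "finite B" "card A = i" "card B = j" using assms ksetsD by blast+
  then show "card (A \<inter> B) + card (A \<union> B) = i + j" using card_Un_Int[of A B] by simp
  have "A \<union> B \<subseteq> {1..n}" using assms ksetsD by blast
  then show "card (A \<union> B) \<le> n" using card_mono[of "{1..n}" "A \<union> B"] by simp
qed

lemma card_ksets_le: "F \<subseteq> ksets n k \<Longrightarrow> card F \<le> n choose k"
  using card_mono[OF finite_ksets] card_ksets by metis

text \<open>The shadow of \<open>F\<close> and the complements of \<open>H\<close> both lie in level
  \<open>i - u\<close>. They are disjoint: if the complement of \<open>B\<close> lies in
  \<open>A\<close>, then \<open>A \<union> B\<close> is everything and
  \<open>card (A \<inter> B) = u\<close>. For \<open>n + u \<le> 2 * i\<close> the shadow is at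
  least as large as \<open>F\<close>.\<close>

lemma cross_bound_large:
  assumes F: "F \<subseteq> ksets n i" and H: "H \<subseteq> ksets n j" and x: "cross_intersecting (Suc u) F H"
    and ij: "i + j = n + u" "u \<le> i" "n + u \<le> 2 * i"
  shows "card F + card H \<le> n choose j"
proof -
  let ?C = "(\<lambda>B. {1..n} - B) ` H"
  have j: "j \<le> n" "n - j = i - u" using ij by auto
  have sh: "shadow (i - u) F \<subseteq> ksets n (i - u)" using F by (rule shadow_subset_ksets)
  have C: "?C \<subseteq> ksets n (i - u)" using complement_in_ksets H j by (metis image_subsetI subset_iff)
  have disj: "shadow (i - u) F \<inter> ?C = {}"
  proof (rule ccontr)
    assume "shadow (i - u) F \<inter> ?C \<noteq> {}"
    then obtain B A where AB: "B \<in> H" "A \<in> F" "{1..n} - B \<subseteq> A" by (auto simp: shadow_def)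
    then have k: "A \<in> ksets n i" "B \<in> ksets n j" using F H by auto
    have "A \<union> B = {1..n}" using ksetsD(1)[OF k(1)] ksetsD(1)[OF k(2)] AB(3) by blast
    then have "card (A \<inter> B) = u" using card_Int_complement[OF k] ij by simp
    then show False using cross_intersectingD[OF x AB(2,1)] by simp
  qed
  have "card F \<le> card (shadow (i - u) F)"
    using F ij by (intro card_le_card_shadow[of F n "i - u" u]) auto
  moreover have "card ?C = card H" using H ksetsD(1) by (intro card_complements) blast
  moreover have "card (shadow (i - u) F) + card ?C = card (shadow (i - u) F \<union> ?C)"
    using disj sh C finite_subset[OF _ finite_ksets] by (metis card_Un_disjoint)
  moreover have "\<dots> \<le> n choose (i - u)" using sh C by (intro card_ksets_le) auto
  moreover have "n choose (i - u) = n choose j" using binomial_symmetric[OF j(1)] j(2) by simp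
  ultimately show ?thesis by linarith
qed

text \<open>Induction on \<open>n\<close> after compressing \<open>F\<close>. Splitting at the last
  point, the members of \<open>F\<close> without it are paired with the members of \<open>H\<close>
  containing it, and vice versa; both pairs satisfy the size relation for \<open>n - 1\<close>, and
  the two bounds add up by Pascal's rule.\<close>

lemma cross_bound:
  assumes "F \<subseteq> ksets n i" "H \<subseteq> ksets n j" "intersecting t F" "cross_intersecting (Suc u) F H"
    and "i + j = n + u" "u \<le> t" "1 \<le> t"
  shows "card F + card H \<le> n choose j"
  using assms
proof (induction n arbitrary: i j F H rule: less_induct)
  case (less n)
  show ?case
  proof (cases "F = {}")
    case True then show ?thesis using card_ksets_le[OF less.prems(2)] by simp
  next
    case False
    then obtain A where A: "A \<in> F" by blast
    then have "A \<in> ksets n i" using less.prems(1) by blast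
    then have ti: "t \<le> i"
      using cross_intersectingD[OF less.prems(3) A A] ksetsD(2)[of A n i] by simp
    show ?thesis
    \<comment> \<open>As \<open>u \<le> t\<close>, failure of this condition means
      \<open>2 * i < n + t\<close>, which leaves a point outside any two members of \<open>F\<close>
      that meet in exactly \<open>t\<close> points.\<close>
    proof (cases "n + u \<le> 2 * i \<and> n + t \<le> 2 * i")
      case True
      then show ?thesis
        using less.prems(5,6) ti
        by (intro cross_bound_large[OF less.prems(1,2,4)]) auto
    next
      case small: False
      obtain F' H' where F': "F' \<subseteq> ksets n i" "H' \<subseteq> ksets n j" "intersecting t F'"
        "cross_intersecting (Suc u) F' H'" "left_compressed F'"
        and cards: "card F' = card F" "card H' = card H"
        by (rule exists_left_compressed[OF less.prems(1-4)]) (rule that)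
      have "2 * i < n + t" using small less.prems(6) by auto
      moreover have "i < n" using calculation ti by auto
      ultimately obtain m where n: "n = Suc m" by (cases n) auto
      have j: "1 \<le> j" "1 \<le> i" using less.prems(5,7) \<open>i < n\<close> ti by auto
      let ?F0 = "{A \<in> F'. Suc m \<notin> A}" and ?F1 = "(\<lambda>A. A - {Suc m}) ` {A \<in> F'. Suc m \<in> A}"
      let ?H0 = "{A \<in> H'. Suc m \<notin> A}" and ?H1 = "(\<lambda>A. A - {Suc m}) ` {A \<in> H'. Suc m \<in> A}"
      note F = split_last[OF F'(1)[unfolded n] j(2)] and H = split_last[OF F'(2)[unfolded n] j(1)]
      have "card ?F0 + card ?H1 \<le> m choose (j - 1)"
      proof (rule less.IH[OF _ F(1) H(2)])
        show "intersecting t ?F0" using F'(3) by (auto simp: cross_intersecting_def)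
        show "cross_intersecting (Suc u) ?F0 ?H1" unfolding cross_intersecting_def
        proof (intro ballI)
          fix A B assume "A \<in> ?F0" "B \<in> ?H1"
          then obtain B' where "B' \<in> H'" "A \<in> F'" "A \<inter> B = A \<inter> B'" by blast
          then show "Suc u \<le> card (A \<inter> B)" using cross_intersectingD[OF F'(4)] by simp
        qed
      qed (use n j less.prems(5-7) in auto)
      moreover have "card ?F1 + card ?H0 \<le> m choose j"
      proof (rule less.IH[OF _ F(2) H(1)])
        show "cross_intersecting (Suc u) ?F1 ?H0" unfolding cross_intersecting_def
        proof (intro ballI)
          fix A B assume "A \<in> ?F1" "B \<in> ?H0"
          then obtain A' where "B \<in> H'" "A' \<in> F'" "A \<inter> B = A' \<inter> B" by blast
          then show "Suc u \<le> card (A \<inter> B)" using cross_intersectingD[OF F'(4)] by simp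
        qed
        show "intersecting t ?F1" unfolding cross_intersecting_def
        proof (intro ballI)
          fix A1 B1 assume "A1 \<in> ?F1" "B1 \<in> ?F1"
          then obtain A B where A: "A \<in> F'" "Suc m \<in> A" "A1 = A - {Suc m}"
            and B: "B \<in> F'" "Suc m \<in> B" "B1 = B - {Suc m}" by blast
          have k: "A \<in> ksets n i" "B \<in> ksets n i" using A B F'(1) by auto
          have AB: "t \<le> card (A \<inter> B)" using cross_intersectingD[OF F'(3)] A B by blast
          have e: "card (A1 \<inter> B1) = card (A \<inter> B) - 1"
          proof -
            have "A1 \<inter> B1 = A \<inter> B - {Suc m}" using A B by auto
            then show ?thesis using A B by simp
          qed
          \<comment> \<open>Deleting the common last point could only hurt if \<open>A\<close> and
            \<open>B\<close> meet in exactly \<open>t\<close> points. Then some \<open>x\<close>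
            lies outside both, and compression replaces the last point of \<open>A\<close> by
            \<open>x\<close>; the result meets \<open>B\<close> in precisely
            \<open>A1 \<inter> B1\<close>.\<close>
          show "t \<le> card (A1 \<inter> B1)"
          proof (rule ccontr)
            assume "\<not> t \<le> card (A1 \<inter> B1)"
            then have "card (A \<inter> B) = t" using AB e by linarith
            then have "card (A \<union> B) < n" using card_Int_complement(1)[OF k] \<open>2 * i < n + t\<close> by linarith
            then have "\<not> {1..n} \<subseteq> A \<union> B"
              using card_mono[of "A \<union> B" "{1..n}"] ksetsD(3)[OF k(1)] ksetsD(3)[OF k(2)] by auto
            then obtain x where x: "x \<in> {1..n}" "x \<notin> A" "x \<notin> B" by blast
            then have "x \<noteq> Suc m" using A(2) by blast
            then have "x < Suc m" using n x(1) by simp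
            then have "insert x (A - {Suc m}) \<in> F'"
              using left_compressedD[OF F'(5) A(1)] x A(2) by auto
            then have "t \<le> card (insert x (A - {Suc m}) \<inter> B)"
              using cross_intersectingD[OF F'(3)] B(1) by blast
            moreover have "insert x (A - {Suc m}) \<inter> B = A1 \<inter> B1" using x A B by auto
            ultimately show False using \<open>\<not> t \<le> card (A1 \<inter> B1)\<close> by simp
          qed
        qed
      qed (use n j less.prems(5-7) in auto)
      moreover have "n choose j = (m choose (j - 1)) + (m choose j)"
        using n j(1) by (cases j) auto
      ultimately show ?thesis using F(3) H(3) cards by linarith
    qed
  qed
qed

subsection \<open>Antichains above the middle\<close>

text \<open>The top level is repeatedly replaced by its shadow one level below. The shadow is
  disjoint from the rest and the family remains an antichain, while \<open>n \<le> 2 * s + 1\<close>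
  ensures that no size is lost, until everything lies in level \<open>s\<close>.\<close>

lemma card_antichain_le:
  assumes "F \<subseteq> Pow {1..n}" "\<And>A. A \<in> F \<Longrightarrow> s \<le> card A"
    "\<And>A B. A \<in> F \<Longrightarrow> B \<in> F \<Longrightarrow> A \<subseteq> B \<Longrightarrow> A = B" "n \<le> 2 * s + 1"
  shows "card F \<le> n choose s"
proof -
  have "card F \<le> n choose s"
    if "F \<subseteq> Pow {1..n}" "\<And>A. A \<in> F \<Longrightarrow> s \<le> card A \<and> card A \<le> s + m"
      "\<And>A B. A \<in> F \<Longrightarrow> B \<in> F \<Longrightarrow> A \<subseteq> B \<Longrightarrow> A = B" for m F
    using that
  proof (induction m arbitrary: F)
    case 0
    have "F \<subseteq> ksets n s"
    proof
      fix A assume "A \<in> F"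
      then have "A \<subseteq> {1..n}" "card A = s" using 0(1) 0(2)[of A] by auto
      then show "A \<in> ksets n s" by (rule ksetsI)
    qed
    then show ?case by (rule card_ksets_le)
  next
    case (Suc m)
    define T where "T = {A \<in> F. card A = s + m + 1}"
    define S where "S = shadow (s + m) T"
    have T: "T \<subseteq> ksets n (s + m + 1)" using Suc.prems(1) by (auto simp: T_def ksets_def)
    have S: "S \<subseteq> ksets n (s + m)" unfolding S_def using T by (rule shadow_subset_ksets)
    have SD: "card B = s + m" "\<exists>A\<in>F. B \<subset> A" "finite B" if BS: "B \<in> S" for B
    proof -
      have "B \<in> ksets n (s + m)" using BS S by blast
      then show "card B = s + m" "finite B" by (fact ksetsD)+
      obtain A where "A \<in> T" "B \<subseteq> A" using BS unfolding S_def shadow_def by blast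
      moreover have "card A \<noteq> card B" using \<open>A \<in> T\<close> \<open>card B = s + m\<close> by (simp add: T_def)
      ultimately show "\<exists>A\<in>F. B \<subset> A" by (intro bexI[of _ A]) (auto simp: T_def)
    qed
    have anti: "\<not> A \<subset> B" if "A \<in> F" "B \<in> F" for A B using Suc.prems(3)[OF that] by blast
    have FT: "card A \<le> s + m" "A \<in> F" if "A \<in> F - T" for A
      using that Suc.prems(2)[of A] by (auto simp: T_def)
    have "card ((F - T) \<union> S) \<le> n choose s"
    proof (rule Suc.IH)
      show "(F - T) \<union> S \<subseteq> Pow {1..n}" using Suc.prems(1) S ksetsD(1) by blast
      show "s \<le> card A \<and> card A \<le> s + m" if "A \<in> (F - T) \<union> S" for A
        using that FT[of A] SD(1)[of A] Suc.prems(2)[of A] by auto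
      show "A = B" if AB: "A \<in> (F - T) \<union> S" "B \<in> (F - T) \<union> S" "A \<subseteq> B" for A B
      proof (cases "B \<in> S")
        case True
        show ?thesis
        proof (cases "A \<in> S")
          case True then show ?thesis
            using card_subset_eq[OF SD(3)[OF \<open>B \<in> S\<close>] AB(3)] SD(1)[OF True] SD(1)[OF \<open>B \<in> S\<close>]
            by simp
        next
          case False
          then have "A \<in> F" using AB FT by blast
          then show ?thesis using SD(2)[OF \<open>B \<in> S\<close>] AB(3) anti by blast
        qed
      next
        case False
        then have B: "B \<in> F" "card B \<le> s + m" using AB FT by blast+
        show ?thesis
        proof (cases "A \<in> S")
          case True
          have "B \<subseteq> {1..n}" using B Suc.prems(1) by blast
          then have "finite B" by (rule finite_subset) simp
          then show ?thesis using card_seteq[OF _ AB(3)] SD(1)[OF True] B by simp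
        next
          case False then show ?thesis using AB FT B Suc.prems(3) by blast
        qed
      qed
    qed
    moreover have "(F - T) \<inter> S = {}" using SD(2) anti by blast
    moreover have "finite F" using Suc.prems(1) by (rule finite_subset) simp
    moreover have "finite S" using S by (rule finite_subset) simp
    moreover have "card T \<le> card S" unfolding S_def
      using T assms(4) by (intro card_le_card_shadow[of T n "s + m" 1]) auto
    moreover have "card F = card (F - T) + card T"
    proof -
      have "T \<subseteq> F" by (auto simp: T_def)
      then show ?thesis
        using \<open>finite F\<close> card_mono[of F T] card_Diff_subset[of T F] finite_subset[of T F] by simp
    qed
    ultimately show ?case by (simp add: card_Un_disjoint)
  qed
  note * = this[of F n]
  have "card A \<le> s + n" if "A \<in> F" for A
  proof -
    have "card A \<le> n" using that assms(1) card_mono[of "{1..n}" A] by auto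
    then show ?thesis by simp
  qed
  then show ?thesis using * assms(1-3) by blast
qed


subsection \<open>Generated optimal families\<close>

definition optimal :: "nat \<Rightarrow> nat \<Rightarrow> nat \<Rightarrow> nat set set \<Rightarrow> bool" where
  "optimal n k t F \<longleftrightarrow> F \<subseteq> ksets n k \<and> intersecting t F \<and>
     (\<forall>H. H \<subseteq> ksets n k \<longrightarrow> intersecting t H \<longrightarrow> card H \<le> card F)"

text \<open>For \<open>F\<close> inside level \<open>k\<close> this says that the traces of members
  on \<open>{1..m}\<close> form a generating family: \<open>F\<close> consists of all
  \<open>k\<close>-sets that contain one of these traces.\<close>

definition generated :: "nat \<Rightarrow> nat \<Rightarrow> nat \<Rightarrow> nat set set \<Rightarrow> bool" where
  "generated n k m F \<longleftrightarrow> (\<forall>A\<in>F. \<forall>B\<in>ksets n k. A \<inter> {1..m} \<subseteq> B \<longrightarrow> B \<in> F)"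

lemma generatedD:
  "generated n k m F \<Longrightarrow> A \<in> F \<Longrightarrow> B \<in> ksets n k \<Longrightarrow> A \<inter> {1..m} \<subseteq> B \<Longrightarrow> B \<in> F"
  unfolding generated_def by blast

text \<open>As long as \<open>A\<close> and \<open>B\<close> meet in at least \<open>t\<close>
  points, \<open>2 * k < n + t\<close> leaves a point \<open>w\<close> outside both. A common point
  \<open>z\<close> not in both cores is replaced by \<open>w\<close> in a set whose core avoids
  \<open>z\<close>, which shrinks the intersection.\<close>

lemma exists_small_intersection:
  assumes "2 * k < n + t" "A \<in> ksets n k" "X \<subseteq> A" "B \<in> ksets n k" "Y \<subseteq> B" "card (X \<inter> Y) < t"
  shows "\<exists>A B. A \<in> ksets n k \<and> X \<subseteq> A \<and> B \<in> ksets n k \<and> Y \<subseteq> B \<and> card (A \<inter> B) < t"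
  using assms(2-5)
proof (induction "card (A \<inter> B)" arbitrary: A B rule: less_induct)
  case less
  note k = less.prems(1,3)
  have fin: "finite A" "finite B" using k ksetsD(3) by blast+
  show ?case
  proof (cases "card (A \<inter> B) < t")
    case True then show ?thesis using less.prems by blast
  next
    case False
    then have "card (A \<union> B) < n" using card_Int_complement(1)[OF k] assms(1) by linarith
    then have "\<not> {1..n} \<subseteq> A \<union> B" using card_mono[of "A \<union> B" "{1..n}"] fin by auto
    then obtain w where w: "w \<in> {1..n}" "w \<notin> A" "w \<notin> B" by blast
    then have w': "1 \<le> w" "w \<le> n" by simp_all
    have "A \<inter> B \<noteq> X \<inter> Y" using False assms(6) by force
    then obtain z where z: "z \<in> A" "z \<in> B" "z \<notin> X \<or> z \<notin> Y" using less.prems by blast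
    have small: "card (A \<inter> B - {z}) < card (A \<inter> B)" using z fin by (intro psubset_card_mono) auto
    from z(3) show ?thesis
    proof
      assume "z \<notin> X"
      have "insert w (A - {z}) \<inter> B = A \<inter> B - {z}" using w by blast
      then show ?thesis
        using less.hyps[of "insert w (A - {z})" B] small less.prems \<open>z \<notin> X\<close>
          insert_remove_ksets[OF k(1) z(1) w(2) w'] by force
    next
      assume "z \<notin> Y"
      have "A \<inter> insert w (B - {z}) = A \<inter> B - {z}" using w by blast
      then show ?thesis
        using less.hyps[of A "insert w (B - {z})"] small less.prems \<open>z \<notin> Y\<close>
          insert_remove_ksets[OF k(2) z(2) w(3) w'] by force
    qed
  qed
qed

text \<open>If all \<open>k\<close>-sets over the cores \<open>X\<close> and \<open>Y\<close> are
  members, the cores themselves must meet in \<open>t\<close> points, as otherwise they would extend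
  to two members with a smaller intersection.\<close>

lemma core_intersection:
  assumes "2 * k < n + t" "intersecting t F" "A \<in> ksets n k" "X \<subseteq> A" "B \<in> ksets n k" "Y \<subseteq> B"
    "\<And>A. A \<in> ksets n k \<Longrightarrow> X \<subseteq> A \<Longrightarrow> A \<in> F" "\<And>B. B \<in> ksets n k \<Longrightarrow> Y \<subseteq> B \<Longrightarrow> B \<in> F"
  shows "t \<le> card (X \<inter> Y)"
proof (rule ccontr)
  assume "\<not> t \<le> card (X \<inter> Y)"
  then obtain A B where "A \<in> ksets n k" "X \<subseteq> A" "B \<in> ksets n k" "Y \<subseteq> B" "card (A \<inter> B) < t"
    using exists_small_intersection[OF assms(1,3-6)] by (meson not_le)
  then show False using cross_intersectingD[OF assms(2), of A B] assms(7)[of A] assms(8)[of B] by simp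
qed

lemma generated_intersection:
  assumes "2 * k < n + t" "F \<subseteq> ksets n k" "intersecting t F" "generated n k m F" "A \<in> F" "B \<in> F"
  shows "t \<le> card (A \<inter> B \<inter> {1..m})"
proof -
  have "t \<le> card ((A \<inter> {1..m}) \<inter> (B \<inter> {1..m}))"
    by (rule core_intersection[OF assms(1,3), of A _ B])
      (use assms(2,5,6) generatedD[OF assms(4)] in blast)+
  also have "(A \<inter> {1..m}) \<inter> (B \<inter> {1..m}) = A \<inter> B \<inter> {1..m}" by blast
  finally show ?thesis .
qed

section \<open>Exchanging members at the last generating point\<close>

lemma card_fiber:
  assumes "S \<subseteq> {1..m}" "m \<le> n" "card S \<le> k"
  shows "card {B \<in> ksets n k. B \<inter> {1..m} = S} = (n - m) choose (k - card S)"
proof -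
  have fS: "finite S" using assms(1) by (rule finite_subset) simp
  have "bij_betw (\<lambda>C. S \<union> C) {C. C \<subseteq> {m+1..n} \<and> card C = k - card S} {B \<in> ksets n k. B \<inter> {1..m} = S}"
  proof (rule bij_betw_byWitness[where f' = "\<lambda>B. B - {1..m}"])
    show "\<forall>C\<in>{C. C \<subseteq> {m+1..n} \<and> card C = k - card S}. S \<union> C - {1..m} = C"
    proof
      fix C assume "C \<in> {C. C \<subseteq> {m+1..n} \<and> card C = k - card S}"
      then have "C \<inter> {1..m} = {}" by fastforce
      then show "S \<union> C - {1..m} = C" using assms(1) by blast
    qed
    show "\<forall>B\<in>{B \<in> ksets n k. B \<inter> {1..m} = S}. S \<union> (B - {1..m}) = B" by blast
    show "(\<lambda>C. S \<union> C) ` {C. C \<subseteq> {m+1..n} \<and> card C = k - card S} \<subseteq> {B \<in> ksets n k. B \<inter> {1..m} = S}"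
    proof
      fix B assume "B \<in> (\<lambda>C. S \<union> C) ` {C. C \<subseteq> {m+1..n} \<and> card C = k - card S}"
      then obtain C where C: "C \<subseteq> {m+1..n}" "card C = k - card S" "B = S \<union> C" by blast
      have d: "C \<inter> {1..m} = {}" using C(1) by fastforce
      have "finite C" using C(1) by (rule finite_subset) simp
      moreover have "S \<inter> C = {}" using d assms(1) by blast
      ultimately have "card B = k" using fS C assms(3) by (simp add: card_Un_disjoint)
      moreover have "{m+1..n} \<subseteq> {1..n}" "{1..m} \<subseteq> {1..n}" using assms(2) by auto
      then have "B \<subseteq> {1..n}" using C assms(1) by blast
      moreover have "B \<inter> {1..m} = S" using d assms(1) C(3) by blast
      ultimately show "B \<in> {B \<in> ksets n k. B \<inter> {1..m} = S}" using ksetsI by blast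
    qed
    show "(\<lambda>B. B - {1..m}) ` {B \<in> ksets n k. B \<inter> {1..m} = S} \<subseteq> {C. C \<subseteq> {m+1..n} \<and> card C = k - card S}"
    proof
      fix C assume "C \<in> (\<lambda>B. B - {1..m}) ` {B \<in> ksets n k. B \<inter> {1..m} = S}"
      then obtain B where B: "B \<in> ksets n k" "B \<inter> {1..m} = S" "C = B - {1..m}" by blast
      have "C \<subseteq> {1..n} - {1..m}" using ksetsD(1)[OF B(1)] B(3) by blast
      also have "\<dots> \<subseteq> {m+1..n}" by auto
      finally have "C \<subseteq> {m+1..n}" .
      moreover have "C = B - S" using B by blast
      moreover have "card (B - S) = k - card S"
        using B(2) fS ksetsD(2)[OF B(1)] by (subst card_Diff_subset) auto
      ultimately show "C \<in> {C. C \<subseteq> {m+1..n} \<and> card C = k - card S}" by simp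
    qed
  qed
  then have "card {B \<in> ksets n k. B \<inter> {1..m} = S} = card {C. C \<subseteq> {m+1..n} \<and> card C = k - card S}"
    by (rule bij_betw_same_card[symmetric])
  also have "\<dots> = card {m+1..n} choose (k - card S)" by (rule n_subsets) simp
  finally show ?thesis by simp
qed

lemma card_fibers:
  assumes "\<And>S. S \<in> E \<Longrightarrow> S \<subseteq> {1..m} \<and> card S = e" "m \<le> n" "e \<le> k"
  shows "card {B \<in> ksets n k. B \<inter> {1..m} \<in> E} = card E * ((n - m) choose (k - e))"
proof -
  have "finite E" by (rule finite_subset[of _ "Pow {1..m}"]) (use assms(1) in auto)
  have "{B \<in> ksets n k. B \<inter> {1..m} \<in> E} = (\<Union>S\<in>E. {B \<in> ksets n k. B \<inter> {1..m} = S})" by blast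
  then have "card {B \<in> ksets n k. B \<inter> {1..m} \<in> E} = (\<Sum>S\<in>E. card {B \<in> ksets n k. B \<inter> {1..m} = S})"
    using \<open>finite E\<close> by (simp only:) (rule card_UN_disjoint; auto)
  also have "\<dots> = (\<Sum>S\<in>E. (n - m) choose (k - e))"
    using assms by (intro sum.cong refl) (metis card_fiber)
  finally show ?thesis by simp
qed

lemma binomial_step:
  assumes "N = a + d" shows "(N choose (a + 1)) * (a + 1) = (N choose a) * d"
  using binomial_absorb_comp[of N a] binomial_absorption[of a N] assms
  by (cases N) (auto simp: mult.commute)

text \<open>With \<open>U = x * (N choose a)\<close> and \<open>V = y * (N choose b)\<close>, the
  hypotheses become \<open>U * (b + c) \<le> V * (a + 1)\<close> and
  \<open>V * (a + c) \<le> U * (b + 1)\<close>. For \<open>c \<ge> 2\<close> their sum forces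
  \<open>U = V = 0\<close>. The lemma rules out profitable exchanges failing in both directions
  between two sizes of traces.\<close>

lemma exchange_numeric:
  fixes x y a b c N :: nat
  assumes "x * (N choose (a + 1)) \<le> y * (N choose b)" "y * (N choose (b + 1)) \<le> x * (N choose a)"
    "N = a + b + c" "2 \<le> c" "0 < x"
  shows False
proof -
  define U V where "U = x * (N choose a)" and "V = y * (N choose b)"
  have "(N choose (a + 1)) * (a + 1) = (N choose a) * (b + c)"
    by (rule binomial_step) (simp add: assms(3))
  moreover have "(N choose (b + 1)) * (b + 1) = (N choose b) * (a + c)"
    by (rule binomial_step) (simp add: assms(3))
  ultimately have "x * (N choose (a + 1)) * (a + 1) = U * (b + c)"
    "y * (N choose (b + 1)) * (b + 1) = V * (a + c)"
    unfolding U_def V_def by (metis mult.assoc)+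
  then have "U * (b + c) \<le> V * (a + 1)" "V * (a + c) \<le> U * (b + 1)"
    using assms(1,2) unfolding U_def V_def by (metis mult_le_mono1)+
  moreover have "U * (b + 2) \<le> U * (b + c)" "V * (a + 2) \<le> V * (a + c)"
    using assms(4) by (simp_all only: mult_le_mono2 add_le_mono order_refl)
  ultimately have "U * (b + 2) \<le> V * (a + 1)" "V * (a + 2) \<le> U * (b + 1)" by linarith+
  then have "U = 0" by (simp add: algebra_simps)
  then show False using assms(3,5) by (simp add: U_def)
qed


text \<open>The point \<open>Suc q\<close> is needed for generation. The slack \<open>c\<close> is
  \<open>n + t - 2 * k\<close>, which is the intersection size of the complements; passing to
  complements exchanges the roles of \<open>t\<close> and \<open>c\<close>, so the locale can serve
  for a family and for its dual.\<close>

locale generated_optimal =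
  fixes n k t c q :: nat and F :: "nat set set"
  assumes opt: "optimal n k t F" and compressed: "left_compressed F"
    and gen: "generated n k (Suc q) F" and not_gen: "\<not> generated n k q F"
    and ntc: "n + t = 2 * k + c" and c2: "2 \<le> c" and t1: "1 \<le> t" and qn: "Suc q \<le> n"
begin

text \<open>Members that cannot do without the point \<open>Suc q\<close>: their trace on
  \<open>{1..q}\<close> also lies in a \<open>k\<close>-set outside \<open>F\<close>.\<close>

definition essential :: "nat set set" where
  "essential = {A \<in> F. \<exists>D\<in>ksets n k. D \<notin> F \<and> A \<inter> {1..q} \<subseteq> D}"

definition traces :: "nat set set" where
  "traces = (\<lambda>A. A \<inter> {1..q}) ` essential"

definition extensions :: "nat set set \<Rightarrow> nat set set" where
  "extensions E = {B \<in> ksets n k. \<exists>X\<in>E. X \<subseteq> B}"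

lemma F_ksets: "F \<subseteq> ksets n k" and F_int: "intersecting t F"
  and F_max: "H \<subseteq> ksets n k \<Longrightarrow> intersecting t H \<Longrightarrow> card H \<le> card F"
  using opt unfolding optimal_def by blast+

lemma finite_F: "finite F" using F_ksets by (rule finite_subset) simp

lemma large: "2 * k < n + t" using ntc c2 by simp

lemma essential_F: "A \<in> essential \<Longrightarrow> A \<in> F"
  by (simp add: essential_def)

lemma essential_nonempty: "essential \<noteq> {}"
proof
  assume "essential = {}"
  then have "B \<in> F" if "A \<in> F" "B \<in> ksets n k" "A \<inter> {1..q} \<subseteq> B" for A B
    using that unfolding essential_def by blast
  then have "generated n k q F" unfolding generated_def by blast
  then show False using not_gen by blast
qed

lemma atMost_Suc: "{1..Suc q} = insert (Suc q) {1..q}" by auto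

text \<open>The non-essential part is generated by the first \<open>q\<close> points on its own: a
  set \<open>D\<close> witnessing that \<open>B\<close> is essential would contain the trace of
  \<open>A\<close> too.\<close>

lemma nonessential_generates:
  assumes "A \<in> F - essential" "B \<in> ksets n k" "A \<inter> {1..q} \<subseteq> B"
  shows "B \<in> F - essential"
proof -
  have F: "D \<in> F" if "D \<in> ksets n k" "A \<inter> {1..q} \<subseteq> D" for D
    using that assms(1) unfolding essential_def by blast
  have "B \<notin> essential"
  proof
    assume "B \<in> essential"
    then obtain D where D: "D \<in> ksets n k" "D \<notin> F" "B \<inter> {1..q} \<subseteq> D" unfolding essential_def by blast
    have "A \<inter> {1..q} \<subseteq> D" using assms(3) D(3) by blast
    then show False using F D by blast
  qed
  then show ?thesis using F assms by blast
qed

text \<open>Without \<open>Suc q\<close> the traces on \<open>{1..q}\<close> and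
  \<open>{1..Suc q}\<close> coincide, and the latter generates.\<close>

lemma essential_mem:
  assumes "A \<in> essential" shows "Suc q \<in> A"
proof (rule ccontr)
  assume "Suc q \<notin> A"
  obtain D where D: "D \<in> ksets n k" "D \<notin> F" "A \<inter> {1..q} \<subseteq> D"
    using assms unfolding essential_def by blast
  have "A \<inter> {1..Suc q} \<subseteq> D" using D(3) \<open>Suc q \<notin> A\<close> unfolding atMost_Suc by blast
  then show False using generatedD[OF gen essential_F[OF assms] D(1)] D(2) by blast
qed

lemma int_F: "A \<in> F \<Longrightarrow> B \<in> F \<Longrightarrow> t \<le> card (A \<inter> B \<inter> {1..Suc q})"
  by (rule generated_intersection[OF large F_ksets F_int gen])

lemma int_nonessential:
  assumes "A \<in> F - essential" "B \<in> F"
  shows "t \<le> card (A \<inter> B \<inter> {1..q})"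
proof -
  have "t \<le> card ((A \<inter> {1..q}) \<inter> (B \<inter> {1..Suc q}))"
  proof (rule core_intersection[OF large F_int, of A _ B])
    show "D \<in> F" if "D \<in> ksets n k" "A \<inter> {1..q} \<subseteq> D" for D
      using nonessential_generates[OF assms(1) that] by blast
    show "D \<in> F" if "D \<in> ksets n k" "B \<inter> {1..Suc q} \<subseteq> D" for D
      using generatedD[OF gen assms(2) that] .
  qed (use F_ksets assms in blast)+
  also have "(A \<inter> {1..q}) \<inter> (B \<inter> {1..Suc q}) = A \<inter> B \<inter> {1..q}" unfolding atMost_Suc by blast
  finally show ?thesis .
qed

text \<open>Compression moves \<open>Suc q\<close> to \<open>x\<close> in \<open>A\<close>. As
  \<open>x\<close> is not in \<open>B\<close>, the new set meets \<open>B\<close> inside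
  \<open>{1..Suc q}\<close> only in points of \<open>A\<close> up to \<open>q\<close>.\<close>

lemma int_essential_missing:
  assumes "A \<in> essential" "B \<in> F" "x \<in> {1..q}" "x \<notin> A" "x \<notin> B"
  shows "t \<le> card (A \<inter> B \<inter> {1..q})"
proof -
  have "insert x (A - {Suc q}) \<in> F"
    using left_compressedD[OF compressed essential_F[OF assms(1)], of x "Suc q"]
      essential_mem[OF assms(1)] assms(3,4) by simp
  from int_F[OF this assms(2)]
  have "t \<le> card (insert x (A - {Suc q}) \<inter> B \<inter> {1..Suc q})" .
  also have "insert x (A - {Suc q}) \<inter> B \<inter> {1..Suc q} = (A - {Suc q}) \<inter> B \<inter> {1..q}"
    using assms(5) unfolding atMost_Suc by blast
  also have "(A - {Suc q}) \<inter> B \<inter> {1..q} = A \<inter> B \<inter> {1..q}" by fastforce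
  finally show ?thesis .
qed

text \<open>Dropping \<open>Suc q\<close> costs at most one common point. A loss below
  \<open>t\<close> requires that the traces cover \<open>{1..q}\<close> and share exactly
  \<open>t - 1\<close> points, and this fixes the sum of their sizes.\<close>

lemma int_essential_sizes:
  assumes A: "A \<in> essential" and B: "B \<in> essential"
    and ne: "card (A \<inter> {1..q}) + card (B \<inter> {1..q}) + 1 \<noteq> q + t"
  shows "t \<le> card (A \<inter> B \<inter> {1..q})"
proof (cases "{1..q} \<subseteq> A \<union> B")
  case False
  then show ?thesis using int_essential_missing[OF A essential_F[OF B]] by blast
next
  case True
  have AB: "(A \<inter> {1..q}) \<union> (B \<inter> {1..q}) = {1..q}" "(A \<inter> {1..q}) \<inter> (B \<inter> {1..q}) = A \<inter> B \<inter> {1..q}"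
    using True by blast+
  have "card (A \<inter> {1..q}) + card (B \<inter> {1..q}) = q + card (A \<inter> B \<inter> {1..q})"
    using card_Un_Int[of "A \<inter> {1..q}" "B \<inter> {1..q}"] unfolding AB by simp
  moreover have "t \<le> Suc (card (A \<inter> B \<inter> {1..q}))"
  proof -
    have "A \<inter> B \<inter> {1..Suc q} \<subseteq> insert (Suc q) (A \<inter> B \<inter> {1..q})" unfolding atMost_Suc by blast
    then have "card (A \<inter> B \<inter> {1..Suc q}) \<le> card (insert (Suc q) (A \<inter> B \<inter> {1..q}))"
      by (intro card_mono) auto
    also have "\<dots> \<le> Suc (card (A \<inter> B \<inter> {1..q}))" by (rule card_insert_le_m1) auto
    finally show ?thesis using int_F[OF essential_F[OF A] essential_F[OF B]] by simp
  qed
  ultimately show ?thesis using ne by linarith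
qed

text \<open>The exchange removes the essential members in \<open>R\<close> and adds every
  \<open>k\<close>-set over a trace in \<open>E\<close>, now without demanding \<open>Suc q\<close>.
  Only essential members left in the family need a hypothesis, since non-essential ones already meet
  every member in \<open>t\<close> points up to \<open>q\<close>.\<close>

lemma exchange_intersecting:
  assumes E: "E \<subseteq> traces" and R: "R \<subseteq> essential"
    and i: "\<And>A X. A \<in> essential - R \<Longrightarrow> X \<in> E \<Longrightarrow> t \<le> card (A \<inter> X)"
    and ii: "\<And>X Y. X \<in> E \<Longrightarrow> Y \<in> E \<Longrightarrow> t \<le> card (X \<inter> Y)"
  shows "(F - R) \<union> extensions E \<subseteq> ksets n k" "intersecting t ((F - R) \<union> extensions E)"
proof -
  show "(F - R) \<union> extensions E \<subseteq> ksets n k" using F_ksets unfolding extensions_def by blast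
  have iii: "t \<le> card (A \<inter> X)" if "A \<in> F - R" "X \<in> E" for A X
  proof (cases "A \<in> essential")
    case True then show ?thesis using i that by blast
  next
    case False
    obtain B where B: "B \<in> essential" "X = B \<inter> {1..q}" using \<open>X \<in> E\<close> E unfolding traces_def by blast
    have "t \<le> card (A \<inter> B \<inter> {1..q})"
      using int_nonessential[of A B] False \<open>A \<in> F - R\<close> essential_F[OF B(1)] by blast
    then show ?thesis unfolding B(2) by (simp add: Int_assoc)
  qed
  have mono: "t \<le> card (A \<inter> B)" if "t \<le> card (X \<inter> Y)" "X \<subseteq> A" "Y \<subseteq> B" "finite A" for X Y A B
  proof -
    have "card (X \<inter> Y) \<le> card (A \<inter> B)" using that by (intro card_mono) auto
    then show ?thesis using that(1) by simp
  qed
  have fin: "finite A" if "A \<in> (F - R) \<union> extensions E" for A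
    using that F_ksets ksetsD(3) unfolding extensions_def by blast
  have ext: "\<exists>X\<in>E. X \<subseteq> B" if "B \<in> extensions E" for B using that unfolding extensions_def by blast
  show "intersecting t ((F - R) \<union> extensions E)" unfolding cross_intersecting_def
  proof (intro ballI)
    fix A B assume A: "A \<in> (F - R) \<union> extensions E" and B: "B \<in> (F - R) \<union> extensions E"
    consider "A \<in> F - R" "B \<in> F - R" | "A \<in> F - R" "B \<in> extensions E"
      | "A \<in> extensions E" "B \<in> F - R" | "A \<in> extensions E" "B \<in> extensions E" using A B by blast
    then show "t \<le> card (A \<inter> B)"
    proof cases
      case 1 then show ?thesis using cross_intersectingD[OF F_int] by blast
    next
      case 2
      then obtain X where "X \<in> E" "X \<subseteq> B" using ext by blast
      then show ?thesis using mono[OF iii[OF 2(1)] subset_refl _ fin[OF A]] by blast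
    next
      case 3
      then obtain X where "X \<in> E" "X \<subseteq> A" using ext by blast
      then show ?thesis using mono[OF iii[OF 3(2)] subset_refl _ fin[OF B]] by (metis Int_commute)
    next
      case 4
      then obtain X Y where "X \<in> E" "X \<subseteq> A" "Y \<in> E" "Y \<subseteq> B" using ext by blast
      then show ?thesis using mono[OF ii _ _ fin[OF A]] by blast
    qed
  qed
qed

lemma card_exchange:
  assumes R: "R \<subseteq> essential"
  shows "card ((F - R) \<union> extensions E) + card R = card F + card (extensions E - F)
    + card (extensions E \<inter> R)"
proof -
  have RF: "R \<subseteq> F" using R essential_F by blast
  have fin: "finite R" "finite (extensions E)"
    using finite_subset[OF RF finite_F] finite_subset[of "extensions E" "ksets n k"]
    unfolding extensions_def by auto
  have "(F - R) \<union> extensions E = (F - R) \<union> ((extensions E - F) \<union> (extensions E \<inter> R))" using RF by blast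
  also have "card \<dots> = card (F - R) + card ((extensions E - F) \<union> (extensions E \<inter> R))"
    using fin finite_F by (intro card_Un_disjoint) auto
  also have "card ((extensions E - F) \<union> (extensions E \<inter> R)) = card (extensions E - F) + card (extensions E \<inter> R)"
    using fin RF by (intro card_Un_disjoint) auto
  also have "card (F - R) = card F - card R" using fin RF by (intro card_Diff_subset)
  finally show ?thesis using card_mono[OF finite_F RF] by simp
qed

text \<open>Were \<open>B\<close> a member, its trace \<open>X\<close> on \<open>{1..Suc q}\<close>
  would generate, contrary to the \<open>k\<close>-set outside \<open>F\<close> that contains
  \<open>X\<close>.\<close>

lemma trace_extension_not_in:
  assumes "X \<in> traces" "B \<in> ksets n k" "B \<inter> {1..Suc q} = X"
  shows "B \<notin> F"
proof
  assume "B \<in> F"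
  obtain A where "A \<in> essential" "X = A \<inter> {1..q}" using assms(1) unfolding traces_def by blast
  then obtain D where "D \<in> ksets n k" "D \<notin> F" "X \<subseteq> D" unfolding essential_def by blast
  then show False using generatedD[OF gen \<open>B \<in> F\<close>] assms(3) by blast
qed

lemma traces_subset: "X \<in> traces \<Longrightarrow> X \<subseteq> {1..q}"
  unfolding traces_def by blast

lemma card_trace: assumes "A \<in> essential" shows "card (A \<inter> {1..Suc q}) = card (A \<inter> {1..q}) + 1"
proof -
  have "A \<inter> {1..Suc q} = insert (Suc q) (A \<inter> {1..q})"
    using essential_mem[OF assms] unfolding atMost_Suc by blast
  then show ?thesis by simp
qed

lemma card_traces_less: assumes "X \<in> traces" shows "card X < k"
proof -
  obtain A where A: "A \<in> essential" "X = A \<inter> {1..q}" using assms unfolding traces_def by blast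
  have "A \<in> ksets n k" using essential_F[OF A(1)] F_ksets by blast
  note A' = ksetsD(2,3)[OF this]
  have "Suc q \<notin> X" unfolding A(2) by simp
  then have "X \<subset> A" using A essential_mem[OF A(1)] by blast
  then show ?thesis using psubset_card_mono[OF A'(2)] A'(1) by simp
qed

text \<open>Only the extensions whose trace on \<open>{1..Suc q}\<close> is exactly a member of
  \<open>E\<close> are counted; these are certainly new.\<close>

lemma gain_ge:
  assumes "E \<subseteq> traces" "\<And>X. X \<in> E \<Longrightarrow> card X = e" "e < k"
  shows "card E * ((n - Suc q) choose (k - e)) \<le> card (extensions E - F)"
proof -
  have "card {B \<in> ksets n k. B \<inter> {1..Suc q} \<in> E} = card E * ((n - Suc q) choose (k - e))"
  proof (rule card_fibers)
    fix X assume X: "X \<in> E"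
    then have "X \<subseteq> {1..q}" using assms(1) traces_subset by blast
    then show "X \<subseteq> {1..Suc q} \<and> card X = e" using assms(2)[OF X] unfolding atMost_Suc by blast
  qed (use qn assms(3) in auto)
  moreover have "{B \<in> ksets n k. B \<inter> {1..Suc q} \<in> E} \<subseteq> extensions E - F"
    using trace_extension_not_in assms(1) unfolding extensions_def by blast
  then have "card {B \<in> ksets n k. B \<inter> {1..Suc q} \<in> E} \<le> card (extensions E - F)"
    by (rule card_mono[rotated]) (rule finite_subset[of _ "ksets n k"]; auto simp: extensions_def)
  ultimately show ?thesis by simp
qed

text \<open>The essential members with a trace in \<open>E\<close> are all the \<open>k\<close>-sets
  meeting \<open>{1..Suc q}\<close> in such a trace together with \<open>Suc q\<close>: generation
  makes each of them a member, and the trace on \<open>{1..q}\<close> makes it essential.\<close>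

lemma loss_eq:
  assumes "E \<subseteq> traces" "\<And>X. X \<in> E \<Longrightarrow> card X = e" "e < k"
  shows "card {A \<in> essential. A \<inter> {1..q} \<in> E} = card E * ((n - Suc q) choose (k - Suc e))"
proof -
  have X: "X \<subseteq> {1..q}" if "X \<in> E" for X using that assms(1) traces_subset by blast
  have nX: "Suc q \<notin> X" if "X \<in> E" for X using X[OF that] by auto
  have fX: "finite X" if "X \<in> E" for X using X[OF that] by (rule finite_subset) simp
  have "{A \<in> essential. A \<inter> {1..q} \<in> E} = {B \<in> ksets n k. B \<inter> {1..Suc q} \<in> insert (Suc q) ` E}"
  proof (intro equalityI subsetI)
    fix A assume "A \<in> {A \<in> essential. A \<inter> {1..q} \<in> E}"
    then have A: "A \<in> essential" "A \<inter> {1..q} \<in> E" by auto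
    have "A \<inter> {1..Suc q} = insert (Suc q) (A \<inter> {1..q})"
      using essential_mem[OF A(1)] unfolding atMost_Suc by blast
    moreover have "A \<in> ksets n k" using essential_F[OF A(1)] F_ksets by blast
    ultimately show "A \<in> {B \<in> ksets n k. B \<inter> {1..Suc q} \<in> insert (Suc q) ` E}" using A(2) by blast
  next
    fix B assume "B \<in> {B \<in> ksets n k. B \<inter> {1..Suc q} \<in> insert (Suc q) ` E}"
    then obtain X where B: "B \<in> ksets n k" "X \<in> E" "B \<inter> {1..Suc q} = insert (Suc q) X" by blast
    have BX: "B \<inter> {1..q} = X"
    proof -
      have "B \<inter> {1..q} = (B \<inter> {1..Suc q}) - {Suc q}" by (auto simp: atMost_Suc)
      then show ?thesis using B(3) nX[OF B(2)] by blast
    qed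
    obtain A where A: "A \<in> essential" "X = A \<inter> {1..q}" using B(2) assms(1) unfolding traces_def by blast
    have "A \<inter> {1..Suc q} \<subseteq> B" using A(2) B(3) unfolding atMost_Suc by blast
    then have "B \<in> F" using generatedD[OF gen essential_F[OF A(1)] B(1)] by blast
    moreover obtain D where "D \<in> ksets n k" "D \<notin> F" "X \<subseteq> D" using A unfolding essential_def by blast
    ultimately have "B \<in> essential" using BX unfolding essential_def by blast
    then show "B \<in> {A \<in> essential. A \<inter> {1..q} \<in> E}" using BX B(2) by blast
  qed
  moreover have "card {B \<in> ksets n k. B \<inter> {1..Suc q} \<in> insert (Suc q) ` E} =
      card (insert (Suc q) ` E) * ((n - Suc q) choose (k - Suc e))"
  proof (rule card_fibers)
    fix S assume "S \<in> insert (Suc q) ` E"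
    then obtain X where S: "X \<in> E" "S = insert (Suc q) X" by blast
    have "S \<subseteq> {1..Suc q}" using X[OF S(1)] S(2) unfolding atMost_Suc by blast
    then show "S \<subseteq> {1..Suc q} \<and> card S = Suc e" using S nX[OF S(1)] fX[OF S(1)] assms(2)[OF S(1)] by simp
  qed (use qn assms(3) in auto)
  moreover have "card (insert (Suc q) ` E) = card E"
    by (rule card_image, rule inj_onI) (metis insert_ident nX)
  ultimately show ?thesis by simp
qed

text \<open>Maximality of \<open>F\<close> forbids a net gain. The case of equality is recorded
  because the exchanged family is then a new optimal family, to be played against the minimality of
  the generating number.\<close>

lemma exchange_le:
  assumes "E \<subseteq> traces" "R \<subseteq> essential"
    "\<And>A X. A \<in> essential - R \<Longrightarrow> X \<in> E \<Longrightarrow> t \<le> card (A \<inter> X)"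
    "\<And>X Y. X \<in> E \<Longrightarrow> Y \<in> E \<Longrightarrow> t \<le> card (X \<inter> Y)"
  shows "card (extensions E - F) \<le> card R"
    "card (extensions E - F) = card R \<Longrightarrow> optimal n k t ((F - R) \<union> extensions E)"
proof -
  note X = exchange_intersecting[OF assms]
  have le: "card ((F - R) \<union> extensions E) \<le> card F" using F_max[OF X] .
  then show "card (extensions E - F) \<le> card R" using card_exchange[OF assms(2), of E] by linarith
  assume "card (extensions E - F) = card R"
  then have "card ((F - R) \<union> extensions E) = card F"
    using card_exchange[OF assms(2), of E] le by linarith
  then show "optimal n k t ((F - R) \<union> extensions E)"
    using X F_max unfolding optimal_def by simp
qed

text \<open>All traces of the size of \<open>X\<close> are freed from \<open>Suc q\<close>, and the
  essential members with traces of the complementary size, the only ones that could meet them in too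
  few points, are removed. If there were none of the latter, the exchange would gain a
  \<open>k\<close>-set outside \<open>F\<close> over \<open>X\<close> at no cost.\<close>

lemma traces_opposite_size:
  assumes "X \<in> traces" "2 * card X + 1 \<noteq> q + t"
  defines "Ee \<equiv> {Y \<in> traces. card Y = card X}" and "Ef \<equiv> {Y \<in> traces. card X + card Y + 1 = q + t}"
  shows "Ef \<noteq> {}" "card (extensions Ee - F) \<le> card {A \<in> essential. A \<inter> {1..q} \<in> Ef}"
proof -
  let ?R = "{A \<in> essential. A \<inter> {1..q} \<in> Ef}"
  show le: "card (extensions Ee - F) \<le> card ?R"
  proof (rule exchange_le)
    show "Ee \<subseteq> traces" "?R \<subseteq> essential" by (auto simp: Ee_def)
    fix A Y assume A: "A \<in> essential - ?R" and "Y \<in> Ee"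
    then obtain B where B: "B \<in> essential" "Y = B \<inter> {1..q}" "card Y = card X"
      unfolding Ee_def traces_def by blast
    have "A \<inter> {1..q} \<in> traces" using A unfolding traces_def by blast
    then have "card X + card (A \<inter> {1..q}) + 1 \<noteq> q + t" using A unfolding Ef_def by blast
    then have "t \<le> card (A \<inter> B \<inter> {1..q})" using A B by (intro int_essential_sizes) auto
    then show "t \<le> card (A \<inter> Y)" unfolding B(2) by (simp add: Int_assoc)
  next
    fix Y Z assume "Y \<in> Ee" "Z \<in> Ee"
    then obtain A B where A: "A \<in> essential" "Y = A \<inter> {1..q}" "card Y = card X"
      and B: "B \<in> essential" "Z = B \<inter> {1..q}" "card Z = card X"
      unfolding Ee_def traces_def by blast
    have "t \<le> card (A \<inter> B \<inter> {1..q})" using A B assms(2) by (intro int_essential_sizes) auto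
    moreover have "Y \<inter> Z = A \<inter> B \<inter> {1..q}" using A(2) B(2) by blast
    ultimately show "t \<le> card (Y \<inter> Z)" by simp
  qed
  show "Ef \<noteq> {}"
  proof
    assume "Ef = {}"
    then have "card (extensions Ee - F) = 0" using le by simp
    moreover have "finite (extensions Ee - F)"
      by (rule finite_subset[of _ "ksets n k"]) (auto simp: extensions_def)
    ultimately have e: "extensions Ee - F = {}" by simp
    obtain A where A: "A \<in> essential" "X = A \<inter> {1..q}" using assms(1) unfolding traces_def by blast
    then obtain D where "D \<in> ksets n k" "D \<notin> F" "X \<subseteq> D" unfolding essential_def by blast
    moreover have "X \<in> Ee" using assms(1) by (simp add: Ee_def)
    ultimately show False using e unfolding extensions_def by blast
  qed
qed

text \<open>For two different complementary sizes the exchange can be performed in either direction.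
  That neither produces a gain contradicts \<open>exchange_numeric\<close>, so the sizes
  coincide.\<close>

lemma card_traces:
  assumes X: "X \<in> traces" shows "2 * card X + 1 = q + t"
proof (rule ccontr)
  assume ne: "2 * card X + 1 \<noteq> q + t"
  define Ee where "Ee = {Y \<in> traces. card Y = card X}"
  define Ef where "Ef = {Y \<in> traces. card X + card Y + 1 = q + t}"
  note a = traces_opposite_size[OF X ne, folded Ee_def Ef_def]
  obtain Y where Y: "Y \<in> traces" "card X + card Y + 1 = q + t" using a(1) unfolding Ef_def by blast
  then have ne': "2 * card Y + 1 \<noteq> q + t" using ne by simp
  have Ef: "Ef = {Z \<in> traces. card Z = card Y}" using Y(2) unfolding Ef_def by auto
  have Ee: "Ee = {Z \<in> traces. card Y + card Z + 1 = q + t}" using Y(2) unfolding Ee_def by auto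
  note b = traces_opposite_size(2)[OF Y(1) ne', folded Ee Ef]
  have sub: "Ee \<subseteq> traces" "Ef \<subseteq> traces" by (auto simp: Ee_def Ef_def)
  have e: "card Z = card X" if "Z \<in> Ee" for Z using that by (simp add: Ee_def)
  have f: "card Z = card Y" if "Z \<in> Ef" for Z using that by (simp add: Ef)
  note k = card_traces_less[OF X] card_traces_less[OF Y(1)]
  define N a' b' where "N = n - Suc q" and "a' = k - Suc (card X)" and "b' = k - Suc (card Y)"
  have ab: "k - card X = a' + 1" "k - card Y = b' + 1" using k by (auto simp: a'_def b'_def)
  have "card Ee * (N choose (a' + 1)) \<le> card Ef * (N choose b')"
    using gain_ge[OF sub(1) e k(1)] loss_eq[OF sub(2) f k(2)] a(2) ab by (simp add: N_def b'_def)
  moreover have "card Ef * (N choose (b' + 1)) \<le> card Ee * (N choose a')"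
    using gain_ge[OF sub(2) f k(2)] loss_eq[OF sub(1) e k(1)] b ab by (simp add: N_def a'_def)
  moreover have "N = a' + b' + c" unfolding N_def a'_def b'_def using ntc Y(2) k by simp
  moreover have "0 < card Ee"
  proof -
    have "finite Ee" by (rule finite_subset[of _ "Pow {1..q}"]) (use sub(1) traces_subset in auto)
    moreover have "X \<in> Ee" using X by (simp add: Ee_def)
    ultimately show ?thesis by (metis card_gt_0_iff empty_iff)
  qed
  ultimately show False using exchange_numeric c2 by blast
qed

text \<open>When all traces have the same size, an exchange by size is no longer available. Instead
  the traces avoiding a fixed \<open>p\<close> are freed and the essential members through
  \<open>p\<close> are removed: two sets missing a common point \<open>p\<close> lose nothing by
  \<open>int_essential_missing\<close>.\<close>

lemma exchange_avoiding:
  assumes p: "p \<in> {1..q}"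
  defines "Ep \<equiv> {X \<in> traces. p \<notin> X}" and "Rp \<equiv> {A \<in> essential. p \<in> A}"
  shows "card (extensions Ep - F) \<le> card Rp"
    "card (extensions Ep - F) = card Rp \<Longrightarrow> optimal n k t ((F - Rp) \<union> extensions Ep)"
proof -
  have 1: "Ep \<subseteq> traces" "Rp \<subseteq> essential" by (auto simp: Ep_def Rp_def)
  have 2: "t \<le> card (A \<inter> X)" if A: "A \<in> essential" "p \<notin> A" and "X \<in> Ep" for A X
  proof -
    obtain B where B: "B \<in> essential" "X = B \<inter> {1..q}" "p \<notin> X"
      using \<open>X \<in> Ep\<close> unfolding Ep_def traces_def by blast
    then have "t \<le> card (A \<inter> B \<inter> {1..q})"
      using int_essential_missing[OF A(1) essential_F[OF B(1)] p A(2)] p by blast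
    then show ?thesis unfolding B(2) by (simp add: Int_assoc)
  qed
  have 3: "t \<le> card (X \<inter> Y)" if "X \<in> Ep" "Y \<in> Ep" for X Y
  proof -
    obtain A where A: "A \<in> essential" "X = A \<inter> {1..q}" "p \<notin> X"
      using \<open>X \<in> Ep\<close> unfolding Ep_def traces_def by blast
    have "X \<inter> Y = A \<inter> Y" using A(2) that(2) traces_subset unfolding Ep_def by blast
    then show ?thesis using 2[OF A(1) _ that(2)] A p by simp
  qed
  have 4: "t \<le> card (A \<inter> X)" if "A \<in> essential - Rp" "X \<in> Ep" for A X
    using 2 that unfolding Rp_def by blast
  show "card (extensions Ep - F) \<le> card Rp"
    "card (extensions Ep - F) = card Rp \<Longrightarrow> optimal n k t ((F - Rp) \<union> extensions Ep)"
    using exchange_le[OF 1 4 3] by blast+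
qed

text \<open>Exchanging at the last coordinate \<open>q\<close> keeps the family left-compressed, so that in the case
  of equality it yields an optimal family generated by fewer coordinates.\<close>

lemma exchange_last:
  assumes q: "1 \<le> q"
  defines "Eq \<equiv> {X \<in> traces. q \<notin> X}" and "Rq \<equiv> {A \<in> essential. q \<in> A}"
  shows "left_compressed ((F - Rq) \<union> extensions Eq)" "generated n k q ((F - Rq) \<union> extensions Eq)"
proof -
  \<comment> \<open>An essential member avoiding \<open>q\<close> is itself an extension of its
    trace, so removing all essential members gives the same family.\<close>
  have eq: "(F - Rq) \<union> extensions Eq = (F - essential) \<union> extensions Eq"
  proof -
    have "A \<in> extensions Eq" if A: "A \<in> essential" "q \<notin> A" for A
    proof -
      have "A \<inter> {1..q} \<in> Eq" using A unfolding Eq_def traces_def by blast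
      moreover have "A \<in> ksets n k" using essential_F[OF A(1)] F_ksets by blast
      ultimately show ?thesis unfolding extensions_def by blast
    qed
    then show ?thesis unfolding Rq_def by blast
  qed
  have up: "B \<in> extensions Eq" if "B \<in> ksets n k" "X \<in> Eq" "X \<subseteq> B" for B X
    using that unfolding extensions_def by blast
  show "generated n k q ((F - Rq) \<union> extensions Eq)" unfolding eq generated_def
  proof (intro ballI impI)
    fix A B assume A: "A \<in> (F - essential) \<union> extensions Eq" and B: "B \<in> ksets n k" "A \<inter> {1..q} \<subseteq> B"
    from A show "B \<in> (F - essential) \<union> extensions Eq"
    proof
      assume "A \<in> F - essential"
      then show ?thesis using nonessential_generates B by blast
    next
      assume "A \<in> extensions Eq"
      then obtain X where X: "X \<in> Eq" "X \<subseteq> A" unfolding extensions_def by blast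
      then have "X \<subseteq> B" using traces_subset[of X] B(2) unfolding Eq_def by blast
      then show ?thesis using up[OF B(1) X(1)] by blast
    qed
  qed
  show "left_compressed ((F - Rq) \<union> extensions Eq)" unfolding eq left_compressed_def
  proof (intro ballI allI impI)
    fix C i j
    assume C: "C \<in> (F - essential) \<union> extensions Eq" and ij: "1 \<le> i" "i < j" "j \<in> C" "i \<notin> C"
    have Ck: "C \<in> ksets n k" using C F_ksets unfolding extensions_def by blast
    have i: "i \<le> n" using ksetsD(1)[OF Ck] ij by fastforce
    let ?C = "insert i (C - {j})"
    have C'k: "?C \<in> ksets n k" using insert_remove_ksets[OF Ck ij(3,4,1) i] .
    from C show "?C \<in> (F - essential) \<union> extensions Eq"
    proof
      assume CF: "C \<in> F - essential"
      show ?thesis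
      proof (cases "j \<le> q")
        case False
        then have "C \<inter> {1..q} \<subseteq> ?C" by auto
        then show ?thesis using nonessential_generates[OF CF C'k] by blast
      next
        case True
        have "?C \<in> F" using left_compressedD[OF compressed _ ij] CF by blast
        \<comment> \<open>A set \<open>D\<close> outside \<open>F\<close> over the trace of
          \<open>?C\<close> contains \<open>i\<close> but not \<open>j\<close>. Restoring
          \<open>j\<close> in place of \<open>i\<close> gives a superset of the trace of
          \<open>C\<close>, hence a member, and compressing it returns \<open>D\<close>.\<close>
        moreover have "?C \<notin> essential"
        proof
          assume "?C \<in> essential"
          then obtain D where D: "D \<in> ksets n k" "D \<notin> F" "?C \<inter> {1..q} \<subseteq> D" unfolding essential_def by blast
          have "i \<in> D" using D(3) ij True by auto
          have "j \<notin> D"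
          proof
            assume "j \<in> D"
            then have "C \<inter> {1..q} \<subseteq> D" using D(3) by blast
            then show False using nonessential_generates[OF CF D(1)] D(2) by blast
          qed
          have j: "1 \<le> j" "j \<le> n" using ij True qn by auto
          let ?D = "insert j (D - {i})"
          have "?D \<in> ksets n k" using insert_remove_ksets[OF D(1) \<open>i \<in> D\<close> \<open>j \<notin> D\<close> j] .
          moreover have "C \<inter> {1..q} \<subseteq> ?D" using D(3) ij(4) by blast
          ultimately have "?D \<in> F" using nonessential_generates[OF CF] by blast
          then have "insert i (?D - {j}) \<in> F"
            using left_compressedD[OF compressed _ ij(1,2)] ij(2) by blast
          moreover have "insert i (?D - {j}) = D" using \<open>i \<in> D\<close> \<open>j \<notin> D\<close> by blast
          ultimately show False using D(2) by simp
        qed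
        ultimately show ?thesis by blast
      qed
    next
      assume "C \<in> extensions Eq"
      then obtain X where X: "X \<in> Eq" "X \<subseteq> C" unfolding extensions_def by blast
      show ?thesis
      proof (cases "j \<in> X")
        case False
        then show ?thesis using up[OF C'k X(1)] X(2) by blast
      next
        case True
        obtain A where A: "A \<in> essential" "X = A \<inter> {1..q}" "q \<notin> X"
          using X(1) unfolding Eq_def traces_def by blast
        \<comment> \<open>Here the choice of the last point matters: \<open>j\<close> is in
          \<open>X\<close> and \<open>q\<close> is not, so the replacement takes place strictly
          below \<open>q\<close> and the new trace still avoids \<open>q\<close>.\<close>
        have jq: "j < q" using True A(2,3) le_neq_implies_less by auto
        then have iq: "i \<in> {1..q}" using ij by simp
        then have iA: "i \<notin> A" using A(2) X(2) ij(4) by blast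
        let ?A = "insert i (A - {j})"
        have jA: "j \<in> A" using True A(2) by blast
        have A'F: "?A \<in> F" using left_compressedD[OF compressed essential_F[OF A(1)] ij(1,2) jA iA] .
        have sub: "?A \<inter> {1..q} \<subseteq> ?C" using A(2) X(2) by blast
        show ?thesis
        proof (cases "?A \<in> essential")
          case False
          then show ?thesis using nonessential_generates[OF _ C'k sub] A'F by blast
        next
          case True
          have "q \<noteq> i" using jq ij(2) by simp
          moreover have "q \<notin> A" using A(2,3) q by simp
          ultimately have "q \<notin> ?A" by blast
          then have "?A \<inter> {1..q} \<in> Eq" using True unfolding Eq_def traces_def by blast
          then show ?thesis using up[OF C'k _ sub] by blast
        qed
      qed
    qed
  qed
qed

text \<open>All traces have size \<open>e\<close>, so \<open>n - Suc q = 2 * a + c\<close>, and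
  comparing gain and loss at \<open>p\<close> leaves a linear inequality after cancelling
  \<open>N choose a\<close>. Equality at \<open>p = q\<close> would yield an optimal left-compressed
  family generated by \<open>q\<close> points.\<close>

lemma exchange_counts:
  assumes p: "p \<in> {1..q}" and ka: "k = a + Suc e" and qe: "2 * e + 1 = q + t"
  shows "card {X \<in> traces. p \<notin> X} * (a + c) \<le> card {X \<in> traces. p \<in> X} * (a + 1)"
    and "p = q \<Longrightarrow> (\<And>H. optimal n k t H \<Longrightarrow> left_compressed H \<Longrightarrow> \<not> generated n k q H) \<Longrightarrow>
      card {X \<in> traces. p \<notin> X} * (a + c) < card {X \<in> traces. p \<in> X} * (a + 1)"
proof -
  define N where "N = n - Suc q"
  have N: "N = a + (a + c)" unfolding N_def using ntc ka qe by simp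
  define Ep where "Ep = {X \<in> traces. p \<notin> X}"
  define Ip where "Ip = {X \<in> traces. p \<in> X}"
  have sub: "Ep \<subseteq> traces" "Ip \<subseteq> traces" by (auto simp: Ep_def Ip_def)
  have size: "card X = e" if "X \<in> traces" for X using card_traces[OF that] qe by simp
  have gain: "card Ep * (N choose (a + 1)) \<le> card (extensions Ep - F)"
    using gain_ge[OF sub(1), of e] size sub ka by (auto simp: N_def)
  have "{A \<in> essential. p \<in> A} = {A \<in> essential. A \<inter> {1..q} \<in> Ip}"
    using p unfolding Ip_def traces_def by blast
  moreover have "card {A \<in> essential. A \<inter> {1..q} \<in> Ip} = card Ip * (N choose a)"
    using loss_eq[OF sub(2), of e] size sub ka by (auto simp: N_def)
  ultimately have loss: "card {A \<in> essential. p \<in> A} = card Ip * (N choose a)" by simp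
  have pos: "0 < N choose a" using N by simp
  have step: "(N choose (a + 1)) * (a + 1) = (N choose a) * (a + c)"
    by (rule binomial_step) (rule N)
  note le = exchange_avoiding(1)[OF p, folded Ep_def]
  have "(card Ep * (a + c)) * (N choose a) = card Ep * (N choose (a + 1)) * (a + 1)"
    unfolding mult.assoc step by (simp only: ac_simps)
  also have "\<dots> \<le> card (extensions Ep - F) * (a + 1)" using gain by (rule mult_le_mono1)
  finally have 1: "(card Ep * (a + c)) * (N choose a) \<le> card (extensions Ep - F) * (a + 1)" .
  have 2: "(card Ip * (a + 1)) * (N choose a) = card {A \<in> essential. p \<in> A} * (a + 1)"
    unfolding loss by (simp only: ac_simps)
  have "card (extensions Ep - F) * (a + 1) \<le> card {A \<in> essential. p \<in> A} * (a + 1)"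
    using le by (rule mult_le_mono1)
  with 1 2 have "(card Ep * (a + c)) * (N choose a) \<le> (card Ip * (a + 1)) * (N choose a)" by linarith
  with pos have "card Ep * (a + c) \<le> card Ip * (a + 1)" by simp
  then show "card {X \<in> traces. p \<notin> X} * (a + c) \<le> card {X \<in> traces. p \<in> X} * (a + 1)"
    unfolding Ep_def Ip_def .
  assume pq: "p = q" and noH: "\<And>H. optimal n k t H \<Longrightarrow> left_compressed H \<Longrightarrow> \<not> generated n k q H"
  have "card (extensions Ep - F) \<noteq> card {A \<in> essential. p \<in> A}"
  proof
    assume e: "card (extensions Ep - F) = card {A \<in> essential. p \<in> A}"
    have q: "1 \<le> q" using p pq by simp
    show False
      using exchange_avoiding(2)[OF p, folded Ep_def, OF e] exchange_last[OF q] noH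
      unfolding Ep_def pq by blast
  qed
  with le have "card (extensions Ep - F) < card {A \<in> essential. p \<in> A}" by simp
  then have "card (extensions Ep - F) * (a + 1) < card {A \<in> essential. p \<in> A} * (a + 1)"
    by (rule mult_less_mono1) simp
  with 1 2 have "(card Ep * (a + c)) * (N choose a) < (card Ip * (a + 1)) * (N choose a)" by linarith
  then have "card Ep * (a + c) < card Ip * (a + 1)" by simp
  then show "card {X \<in> traces. p \<notin> X} * (a + c) < card {X \<in> traces. p \<in> X} * (a + 1)"
    unfolding Ep_def Ip_def .
qed

text \<open>The inequalities of \<open>exchange_counts\<close> are summed over all \<open>p\<close>
  in \<open>{1..q}\<close>. Each trace contains \<open>t + r - 1\<close> of these points and misses
  \<open>r\<close>, so the number of traces cancels. A single strict inequality, at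
  \<open>p = q\<close>, makes the sum strict.\<close>

lemma generated_optimal_bound:
  obtains r a where "Suc q = t + 2 * r" "k = a + t + r" "r * (a + c) \<le> (t + r - 1) * (a + 1)"
    "1 \<le> q \<longrightarrow> (\<forall>H. optimal n k t H \<longrightarrow> left_compressed H \<longrightarrow> \<not> generated n k q H) \<longrightarrow>
      r * (a + c) < (t + r - 1) * (a + 1)"
proof -
  obtain X where X: "X \<in> traces" using essential_nonempty unfolding traces_def by blast
  define e where "e = card X"
  have qe: "2 * e + 1 = q + t" unfolding e_def by (rule card_traces[OF X])
  have size: "card Y = e" if "Y \<in> traces" for Y using card_traces[OF that] qe by simp
  have "e < k" unfolding e_def by (rule card_traces_less[OF X])
  then obtain a where ka: "k = a + Suc e" by (metis add.commute less_imp_Suc_add add_Suc_right)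
  obtain A where A: "A \<in> essential" "X = A \<inter> {1..q}" using X unfolding traces_def by blast
  have "t \<le> card (A \<inter> A \<inter> {1..Suc q})" using int_F[OF essential_F[OF A(1)] essential_F[OF A(1)]] .
  then have "t \<le> Suc e" using card_trace[OF A(1)] A(2) by (simp add: e_def)
  then obtain r where r: "Suc e = t + r" using le_Suc_ex by blast
  have q: "Suc q = t + 2 * r" using qe r by simp
  have qr: "q - e = r" "e \<le> q" using qe r t1 by auto
  have fin: "finite traces" by (rule finite_subset[of _ "Pow {1..q}"]) (use traces_subset in auto)
  have in_sum: "(\<Sum>p\<in>{1..q}. card {X \<in> traces. p \<in> X}) = e * card traces"
  proof (rule sum_multicount)
    show "\<forall>X\<in>traces. card {p \<in> {1..q}. p \<in> X} = e"
    proof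
      fix X assume X: "X \<in> traces"
      have "{p \<in> {1..q}. p \<in> X} = X" using traces_subset[OF X] by blast
      then show "card {p \<in> {1..q}. p \<in> X} = e" using size[OF X] by simp
    qed
  qed (use fin in auto)
  have out_sum: "(\<Sum>p\<in>{1..q}. card {X \<in> traces. p \<notin> X}) = r * card traces"
  proof (rule sum_multicount)
    show "\<forall>X\<in>traces. card {p \<in> {1..q}. p \<notin> X} = r"
    proof
      fix X assume X: "X \<in> traces"
      have "{p \<in> {1..q}. p \<notin> X} = {1..q} - X" by blast
      moreover have "finite X" using traces_subset[OF X] by (rule finite_subset) simp
      ultimately show "card {p \<in> {1..q}. p \<notin> X} = r"
        using size[OF X] traces_subset[OF X] qr by (simp add: card_Diff_subset)
    qed
  qed (use fin in auto)
  have pos: "0 < card traces" using fin X by (auto simp: card_gt_0_iff)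
  note C = exchange_counts[OF _ ka qe]
  have "r * card traces * (a + c) = (\<Sum>p\<in>{1..q}. card {X \<in> traces. p \<notin> X} * (a + c))"
    unfolding out_sum[symmetric] by (rule sum_distrib_right)
  moreover have "(\<Sum>p\<in>{1..q}. card {X \<in> traces. p \<in> X} * (a + 1)) = e * card traces * (a + 1)"
    unfolding in_sum[symmetric] by (rule sum_distrib_right[symmetric])
  moreover have "(\<Sum>p\<in>{1..q}. card {X \<in> traces. p \<notin> X} * (a + c)) \<le> (\<Sum>p\<in>{1..q}. card {X \<in> traces. p \<in> X} * (a + 1))"
    by (intro sum_mono C(1))
  ultimately have "r * card traces * (a + c) \<le> e * card traces * (a + 1)" by simp
  then have "card traces * (r * (a + c)) \<le> card traces * (e * (a + 1))" by (simp only: ac_simps)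
  then have weak: "r * (a + c) \<le> (t + r - 1) * (a + 1)" using pos r[symmetric] by simp
  have strict: "r * (a + c) < (t + r - 1) * (a + 1)"
    if q1: "1 \<le> q" and noH: "\<And>H. optimal n k t H \<Longrightarrow> left_compressed H \<Longrightarrow> \<not> generated n k q H"
  proof -
    have "(\<Sum>p\<in>{1..q}. card {X \<in> traces. p \<notin> X} * (a + c)) < (\<Sum>p\<in>{1..q}. card {X \<in> traces. p \<in> X} * (a + 1))"
    proof (rule sum_strict_mono_ex1)
      show "\<forall>p\<in>{1..q}. card {X \<in> traces. p \<notin> X} * (a + c) \<le> card {X \<in> traces. p \<in> X} * (a + 1)"
        using C(1) by blast
      have "q \<in> {1..q}" using q1 by simp
      then show "\<exists>p\<in>{1..q}. card {X \<in> traces. p \<notin> X} * (a + c) < card {X \<in> traces. p \<in> X} * (a + 1)"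
        using C(2)[OF _ refl noH] by blast
    qed simp
    then have "r * card traces * (a + c) < e * card traces * (a + 1)"
      unfolding out_sum[symmetric] in_sum[symmetric] sum_distrib_right .
    then have "card traces * (r * (a + c)) < card traces * (e * (a + 1))" by (simp only: ac_simps)
    then show ?thesis using r[symmetric] by simp
  qed
  show thesis
    by (rule that[of r a]) (use q ka r weak strict in simp_all)
qed

end


subsection \<open>The complete intersection theorem for \<open>n + t = 2 * k + 3\<close>\<close>

text \<open>The complement in \<open>{1..n}\<close>, read from right to left: taking complements turns a left-compressed
  family into a right-compressed one, and the reflection restores the direction.\<close>

definition dual :: "nat \<Rightarrow> nat set \<Rightarrow> nat set" where
  "dual n A = {x \<in> {1..n}. n + 1 - x \<notin> A}"

lemma dual_eq_image: assumes "A \<subseteq> {1..n}" shows "dual n A = (\<lambda>x. n + 1 - x) ` ({1..n} - A)"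
proof (intro equalityI subsetI)
  fix x assume "x \<in> dual n A"
  then have x: "1 \<le> x" "x \<le> n" "n + 1 - x \<notin> A" by (auto simp: dual_def)
  then have "n + 1 - x \<in> {1..n} - A" "x = n + 1 - (n + 1 - x)" by auto
  then show "x \<in> (\<lambda>x. n + 1 - x) ` ({1..n} - A)" by blast
next
  fix x assume "x \<in> (\<lambda>x. n + 1 - x) ` ({1..n} - A)"
  then obtain y where y: "y \<in> {1..n}" "y \<notin> A" "x = n + 1 - y" by blast
  then have "x \<in> {1..n}" "n + 1 - x = y" by auto
  then show "x \<in> dual n A" using y by (simp add: dual_def)
qed

lemma dual_subset: "dual n A \<subseteq> {1..n}" by (auto simp: dual_def)

lemma dual_dual: assumes "A \<subseteq> {1..n}" shows "dual n (dual n A) = A"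
proof (intro equalityI subsetI)
  fix x assume "x \<in> dual n (dual n A)"
  then have "x \<in> {1..n}" "n + 1 - x \<notin> dual n A" by (auto simp: dual_def)
  moreover from this have "n + 1 - x \<in> {1..n}" "n + 1 - (n + 1 - x) = x" by auto
  ultimately show "x \<in> A" by (simp add: dual_def)
next
  fix x assume "x \<in> A"
  then have "x \<in> {1..n}" using assms by blast
  moreover from this have "n + 1 - (n + 1 - x) = x" by auto
  ultimately show "x \<in> dual n (dual n A)" using \<open>x \<in> A\<close> by (simp add: dual_def)
qed

lemma inj_on_reverse: "inj_on (\<lambda>x. n + 1 - x) {1..n::nat}"
  by (rule inj_onI) auto

lemma card_dual: assumes "A \<subseteq> {1..n}" shows "card (dual n A) = n - card A"
proof -
  have "card (dual n A) = card ({1..n} - A)" unfolding dual_eq_image[OF assms]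
    by (rule card_image, rule inj_on_subset[OF inj_on_reverse]) blast
  then show ?thesis using assms finite_subset[OF assms] by (simp add: card_Diff_subset)
qed

lemma dual_ksets: assumes "A \<in> ksets n k" shows "dual n A \<in> ksets n (n - k)"
  using dual_subset card_dual[OF ksetsD(1)[OF assms]] ksetsD(2)[OF assms] by (intro ksetsI) auto

lemma dual_Int: "dual n A \<inter> dual n B = dual n (A \<union> B)" by (auto simp: dual_def)

lemma card_ksets_bound: "A \<in> ksets n k \<Longrightarrow> k \<le> n"
  using card_mono[of "{1..n}" A] ksetsD(1,2)[of A n k] by simp

lemma dual_image_ksets: "F \<subseteq> ksets n k \<Longrightarrow> dual n ` F \<subseteq> ksets n (n - k)"
  using dual_ksets by blast

lemma card_dual_image: assumes "F \<subseteq> ksets n k" shows "card (dual n ` F) = card F"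
proof (rule card_image, rule inj_onI)
  fix A B assume "A \<in> F" "B \<in> F" "dual n A = dual n B"
  then show "A = B" using dual_dual[of A n] dual_dual[of B n] assms ksetsD(1) by (metis subsetD)
qed

lemma dual_dual_image: assumes "F \<subseteq> ksets n k" shows "dual n ` dual n ` F = F"
proof -
  have "dual n (dual n A) = A" if "A \<in> F" for A using that assms by (intro dual_dual ksetsD(1)) blast
  then show ?thesis by (simp add: image_image)
qed

text \<open>Complements meet in \<open>n - card (A \<union> B)\<close> points, that is
  \<open>n - 2 * k + card (A \<inter> B)\<close>, and reflection does not change this.\<close>

lemma intersecting_dual:
  assumes F: "F \<subseteq> ksets n k" and int: "intersecting t F" and s: "2 * k + s \<le> n + t"
  shows "intersecting s (dual n ` F)"
  unfolding cross_intersecting_def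
proof (intro ballI)
  fix A' B' assume "A' \<in> dual n ` F" "B' \<in> dual n ` F"
  then obtain A B where A: "A \<in> F" "A' = dual n A" and B: "B \<in> F" "B' = dual n B" by blast
  then have k: "A \<in> ksets n k" "B \<in> ksets n k" using F by auto
  have "A \<union> B \<subseteq> {1..n}" using ksetsD(1)[OF k(1)] ksetsD(1)[OF k(2)] by blast
  then have "card (A' \<inter> B') = n - card (A \<union> B)" unfolding A B dual_Int by (rule card_dual)
  then show "s \<le> card (A' \<inter> B')"
    using card_Int_complement[OF k] cross_intersectingD[OF int A(1) B(1)] s by linarith
qed

lemma optimal_dual:
  assumes opt: "optimal n k t F" and s: "2 * k + s = n + t" and k: "k \<le> n"
  shows "optimal n (n - k) s (dual n ` F)"
proof -
  have F: "F \<subseteq> ksets n k" "intersecting t F" and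
    max: "\<And>H. H \<subseteq> ksets n k \<Longrightarrow> intersecting t H \<Longrightarrow> card H \<le> card F"
    using opt unfolding optimal_def by blast+
  show ?thesis unfolding optimal_def
  proof (intro conjI allI impI)
    show "dual n ` F \<subseteq> ksets n (n - k)" using F(1) by (rule dual_image_ksets)
    show "intersecting s (dual n ` F)" using F s by (intro intersecting_dual) auto
    fix H assume H: "H \<subseteq> ksets n (n - k)" "intersecting s H"
    have "dual n ` H \<subseteq> ksets n k" using dual_image_ksets[OF H(1)] k by simp
    moreover have "intersecting t (dual n ` H)" using H s k by (intro intersecting_dual) auto
    ultimately have "card (dual n ` H) \<le> card F" by (rule max)
    then show "card H \<le> card (dual n ` F)" using card_dual_image[OF H(1)] card_dual_image[OF F(1)] by simp
  qed
qed

text \<open>Trading \<open>j\<close> for \<open>i\<close> in the dual set is trading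
  \<open>n + 1 - i\<close> for \<open>n + 1 - j\<close> in the original one, again a move to the
  left.\<close>

lemma left_compressed_dual:
  assumes F: "F \<subseteq> ksets n k" and lc: "left_compressed F"
  shows "left_compressed (dual n ` F)"
  unfolding left_compressed_def
proof (intro ballI allI impI)
  fix A' i j assume "A' \<in> dual n ` F" and ij: "1 \<le> i" "i < j" "j \<in> A'" "i \<notin> A'"
  then obtain A where A: "A \<in> F" "A' = dual n A" by blast
  have An: "A \<subseteq> {1..n}" using A F ksetsD(1) by blast
  have j: "j \<le> n" "n + 1 - j \<notin> A" using ij(3) A(2) by (auto simp: dual_def)
  have i: "n + 1 - i \<in> A" using ij A(2) j by (auto simp: dual_def)
  have "insert (n + 1 - j) (A - {n + 1 - i}) \<in> F"
    using left_compressedD[OF lc A(1) _ _ i j(2)] ij j by simp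
  moreover have "dual n (insert (n + 1 - j) (A - {n + 1 - i})) = insert i (A' - {j})"
  proof (intro equalityI subsetI)
    fix x assume "x \<in> dual n (insert (n + 1 - j) (A - {n + 1 - i}))"
    then have x: "x \<in> {1..n}" "n + 1 - x \<noteq> n + 1 - j" "n + 1 - x \<notin> A \<or> n + 1 - x = n + 1 - i"
      by (auto simp: dual_def)
    then have "x \<noteq> j" "n + 1 - x \<notin> A \<or> x = i" using ij j by auto
    then show "x \<in> insert i (A' - {j})" using x(1) A(2) by (auto simp: dual_def)
  next
    fix x assume x: "x \<in> insert i (A' - {j})"
    then have xn: "x \<in> {1..n}" "x \<noteq> j" using A(2) ij j by (auto simp: dual_def)
    then have "n + 1 - x \<noteq> n + 1 - j" using j by auto
    moreover have "n + 1 - x \<notin> A - {n + 1 - i}" using x A(2) by (auto simp: dual_def)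
    ultimately show "x \<in> dual n (insert (n + 1 - j) (A - {n + 1 - i}))" using xn by (simp add: dual_def)
  qed
  ultimately show "insert i (A' - {j}) \<in> dual n ` F" by (metis imageI)
qed

text \<open>Dual generation read back on \<open>F\<close>: membership passes from \<open>A\<close>
  to any \<open>k\<close>-set that has no point beyond \<open>m\<close> outside \<open>A\<close>,
  because the first \<open>m'\<close> reflected points all lie beyond \<open>m\<close>.\<close>

lemma generated_dualD:
  assumes F: "F \<subseteq> ksets n k" and gen: "generated n (n - k) m' (dual n ` F)" and mm: "m + m' \<le> n"
    and A: "A \<in> F" and B: "B \<in> ksets n k" "B \<inter> {m+1..n} \<subseteq> A"
  shows "B \<in> F"
proof -
  have "dual n A \<inter> {1..m'} \<subseteq> dual n B"
  proof
    fix x assume "x \<in> dual n A \<inter> {1..m'}"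
    then have x: "1 \<le> x" "x \<le> n" "x \<le> m'" "n + 1 - x \<notin> A" by (auto simp: dual_def)
    then have "n + 1 - x \<in> {m+1..n}" using mm by auto
    then have "n + 1 - x \<notin> B" using B(2) x(4) by blast
    then show "x \<in> dual n B" using x by (simp add: dual_def)
  qed
  then have "dual n B \<in> dual n ` F" using generatedD[OF gen] A dual_ksets[OF B(1)] by blast
  then have "dual n (dual n B) \<in> F" using dual_dual_image[OF F] by (metis imageI)
  then show ?thesis using dual_dual[OF ksetsD(1)[OF B(1)]] by simp
qed

lemma AK_family_le_AK:
  assumes "l \<le> n" "l + 2 * i \<le> n" shows "card (AK_family n k l i) \<le> AK n k l"
  unfolding AK_def using assms by (intro Max_ge) auto

lemma not_generated_0:
  assumes "2 * k < n + t" "F \<subseteq> ksets n k" "intersecting t F" "F \<noteq> {}" "1 \<le> t"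
  shows "\<not> generated n k 0 F"
proof
  assume "generated n k 0 F"
  moreover obtain A where "A \<in> F" using assms(4) by blast
  ultimately have "t \<le> card (A \<inter> A \<inter> {1..0})" using generated_intersection assms(1-3) by blast
  then show False using assms(5) by simp
qed

lemma generated_n: "F \<subseteq> ksets n k \<Longrightarrow> generated n k n F"
  unfolding generated_def
proof (intro ballI impI)
  fix A B assume F: "F \<subseteq> ksets n k" and AB: "A \<in> F" "B \<in> ksets n k" "A \<inter> {1..n} \<subseteq> B"
  have A: "A \<in> ksets n k" using F AB(1) by blast
  then have "A \<subseteq> B" using AB(3) ksetsD(1)[OF A] by blast
  then have "A = B" using card_subset_eq[of B A] ksetsD(2,3)[OF AB(2)] ksetsD(2)[OF A] by simp
  then show "B \<in> F" using AB(1) by simp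
qed

text \<open>The inequalities simplify to \<open>2 * r < (t - 1) * (a + 1)\<close> and
  \<open>r' * (t - 1) \<le> 2 * (a' + 1)\<close>. If \<open>r + r' > s\<close>, then
  \<open>a + 1 \<le> r'\<close> and \<open>a' + 1 \<le> r\<close>, which closes a cycle; one strict
  inequality is enough for the contradiction.\<close>

lemma exchange_parameters:
  fixes a a' r r' t s :: nat
  assumes p: "r * (a + 3) < (t + r - 1) * (a + 1)" and d: "r' * (a' + t) \<le> (3 + r' - 1) * (a' + 1)"
    and s: "a + r = s" "a' + r' = s" and t: "1 \<le> t"
  shows "r + r' \<le> s"
proof (rule ccontr)
  assume "\<not> r + r' \<le> s"
  then have r: "a + 1 \<le> r'" "a' + 1 \<le> r" using s by auto
  obtain u where u: "t = Suc u" using t by (cases t) auto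
  have "2 * r < u * (a + 1)" using p by (simp add: u algebra_simps)
  also have "\<dots> \<le> u * r'" using r(1) by (rule mult_le_mono2)
  finally have "2 * r < u * r'" .
  also have "u * r' \<le> 2 * (a' + 1)" using d by (simp add: u algebra_simps)
  also have "\<dots> \<le> 2 * r" using r(2) by simp
  finally show False by simp
qed

lemma exists_optimal:
  assumes "H \<subseteq> ksets n k" "intersecting t H"
  obtains F where "optimal n k t F" "left_compressed F" "card H \<le> card F"
proof -
  define P where "P G \<longleftrightarrow> G \<subseteq> ksets n k \<and> intersecting t G" for G
  have "P H" using assms by (simp add: P_def)
  moreover have "\<forall>G. P G \<longrightarrow> card G < Suc (card (ksets n k))"
    unfolding P_def less_Suc_eq_le using card_mono[OF finite_ksets] by blast
  ultimately have "\<exists>G. P G \<and> (\<forall>G'. P G' \<longrightarrow> card G' \<le> card G)" by (rule ex_has_greatest_nat)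
  then obtain G where "P G" and max: "\<And>G'. P G' \<Longrightarrow> card G' \<le> card G" by blast
  then have G: "G \<subseteq> ksets n k" "intersecting t G" by (simp_all add: P_def)
  \<comment> \<open>Compression is stated for a pair of families; the empty family serves as a
    companion.\<close>
  have x: "cross_intersecting 0 G {}" "({}::nat set set) \<subseteq> ksets n 0" by (auto simp: cross_intersecting_def)
  obtain F E where "F \<subseteq> ksets n k" "intersecting t F" "left_compressed F" "card F = card G"
    by (rule exists_left_compressed[OF G(1) x(2) G(2) x(1)]) (rule that)
  moreover have "card H' \<le> card G" if "H' \<subseteq> ksets n k" "intersecting t H'" for H'
    using max[of H'] that unfolding P_def by blast
  ultimately show thesis using that[of F] assms unfolding optimal_def by simp
qed

text \<open>By dual generation the part of a member inside \<open>{1..m}\<close> may be replaced by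
  any other of the same size, and by generation the part outside may then be replaced as well. So
  membership depends only on the number of points in \<open>{1..m}\<close>, and too small a number
  would allow two members with fewer than \<open>t\<close> common points there.\<close>

lemma product_family_le:
  assumes F: "F \<subseteq> ksets n k" "intersecting t F" and ntk: "2 * k < n + t" and gen: "generated n k m F"
    and gen': "generated n (n - k) m' (dual n ` F)" and mm: "m + m' \<le> n" and m: "m = t + 2 * r" and t: "1 \<le> t"
  shows "F \<subseteq> AK_family n k t r"
proof
  have swap: "B \<in> F" if A: "A \<in> F" and B: "B \<in> ksets n k" and c: "card (A \<inter> {1..m}) = card (B \<inter> {1..m})" for A B
  proof -
    have Ak: "A \<in> ksets n k" using A F by blast
    let ?C = "(B \<inter> {1..m}) \<union> (A - {1..m})"
    have "card ?C = card (B \<inter> {1..m}) + card (A - {1..m})"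
      using ksetsD(3)[OF Ak] by (intro card_Un_disjoint) auto
    also have "\<dots> = card A" unfolding c[symmetric]
      using card_Diff_subset_Int[of A "{1..m}"] card_mono[of A "A \<inter> {1..m}"] ksetsD(3)[OF Ak] by simp
    finally have "card ?C = k" using ksetsD(2)[OF Ak] by simp
    moreover have "?C \<subseteq> {1..n}" using ksetsD(1)[OF Ak] ksetsD(1)[OF B] by blast
    ultimately have Ck: "?C \<in> ksets n k" by (intro ksetsI)
    have "{1..m} \<inter> {m+1..n} = {}" by auto
    then have "?C \<inter> {m+1..n} \<subseteq> A" by blast
    then have "?C \<in> F" using generated_dualD[OF F(1) gen' mm A Ck] by blast
    moreover have "?C \<inter> {1..m} \<subseteq> B" by blast
    ultimately show ?thesis using generatedD[OF gen _ B] by blast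
  qed
  fix A assume A: "A \<in> F"
  then have Ak: "A \<in> ksets n k" using F by blast
  define X where "X = A \<inter> {1..m}"
  have fX: "finite X" "X \<subseteq> {1..m}" by (auto simp: X_def)
  have cX: "card X \<le> m" using card_mono[OF _ fX(2)] by simp
  have "t + r \<le> card X"
  proof (rule ccontr)
    assume small: "\<not> t + r \<le> card X"
    \<comment> \<open>The least possible overlap of two subsets of \<open>{1..m}\<close> of size
      \<open>card X\<close>, truncated to 0 when disjoint ones exist. The set \<open>Y\<close> below
      realizes it; as \<open>card X < t + r\<close> and \<open>m = t + 2 * r\<close>, it is smaller
      than \<open>t\<close>.\<close>
    let ?d = "2 * card X - m"
    have "?d \<le> card X" using cX by simp
    then obtain Z where Z: "Z \<subseteq> X" "card Z = ?d" "finite Z" by (rule obtain_subset_with_card_n)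
    have cXc: "card ({1..m} - X) = m - card X" using fX by (simp add: card_Diff_subset)
    have "card X - ?d \<le> card ({1..m} - X)" unfolding cXc by simp
    then obtain W where W: "W \<subseteq> {1..m} - X" "card W = card X - ?d" "finite W" by (rule obtain_subset_with_card_n)
    define Y where "Y = Z \<union> W"
    have cY: "card Y = card X"
      unfolding Y_def using Z W \<open>?d \<le> card X\<close> by (subst card_Un_disjoint) auto
    have Ym: "Y \<subseteq> {1..m}" using Z(1) W(1) fX(2) unfolding Y_def by blast
    let ?B = "Y \<union> (A - {1..m})"
    have "card ?B = card Y + card (A - {1..m})"
      using ksetsD(3)[OF Ak] Ym finite_subset[OF Ym] by (intro card_Un_disjoint) auto
    also have "\<dots> = card A" unfolding cY X_def
      using card_Diff_subset_Int[of A "{1..m}"] card_mono[of A "A \<inter> {1..m}"] ksetsD(3)[OF Ak] by simp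
    finally have "card ?B = k" using ksetsD(2)[OF Ak] by simp
    moreover have "{1..m} \<subseteq> {1..n}" using mm by auto
    then have "?B \<subseteq> {1..n}" using ksetsD(1)[OF Ak] Ym by blast
    ultimately have Bk: "?B \<in> ksets n k" by (intro ksetsI)
    have BY: "?B \<inter> {1..m} = Y" using Ym by blast
    have "?B \<in> F" using swap[OF A Bk] unfolding BY cY X_def by simp
    then have "t \<le> card (A \<inter> ?B \<inter> {1..m})" using generated_intersection[OF ntk F gen A] by blast
    moreover have "A \<inter> ?B \<inter> {1..m} = Z" using Z(1) W(1) unfolding X_def Y_def by blast
    ultimately show False using Z(2) small m t by simp
  qed
  then show "A \<in> AK_family n k t r"
    using ksetsD(1,2)[OF Ak] unfolding AK_family_def X_def m by simp
qed

text \<open>The exchange bound is applied to an optimal family with slack 3 and to its dual, where 3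
  and \<open>t\<close> change places. Together they make the two generating intervals disjoint, from
  opposite ends, and \<open>product_family_le\<close> concludes.\<close>

lemma complete_intersection:
  assumes H: "H \<subseteq> ksets n k" "intersecting t H" and ntk: "n + t = 2 * k + 3" and t: "1 \<le> t" "t \<le> n"
  shows "card H \<le> AK n k t"
proof (cases "H = {}")
  case True then show ?thesis by simp
next
  case False
  have "finite H" using H(1) by (rule finite_subset) simp
  then have cH: "0 < card H" using False by (simp add: card_gt_0_iff)
  have large: "2 * k < n + t" using ntk by simp
  \<comment> \<open>The minimum is taken over all left-compressed optimal families, not for a fixed
    one: this makes the bound for \<open>F\<close> strict.\<close>
  define Q where "Q m \<longleftrightarrow> (\<exists>F. optimal n k t F \<and> left_compressed F \<and> generated n k m F)" for m
  define m where "m = (LEAST m. Q m)"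
  obtain F0 where F0: "optimal n k t F0" "left_compressed F0" "card H \<le> card F0"
    by (rule exists_optimal[OF H])
  have "F0 \<subseteq> ksets n k" using F0(1) unfolding optimal_def by blast
  then have Qn: "Q n" unfolding Q_def using F0(1,2) generated_n by blast
  then have "Q m" unfolding m_def by (rule LeastI)
  then obtain F where F: "optimal n k t F" "left_compressed F" "generated n k m F"
    unfolding Q_def by blast
  have Fk: "F \<subseteq> ksets n k" and Fint: "intersecting t F" using F(1) unfolding optimal_def by auto
  have HF: "card H \<le> card F" using F(1) H unfolding optimal_def by blast
  have Fne: "F \<noteq> {}" using HF cH by auto
  then obtain A where A: "A \<in> F" by blast
  have "A \<in> ksets n k" using Fk A by blast
  then have kn: "k \<le> n" by (rule card_ksets_bound)
  have "m \<le> n" unfolding m_def using Qn by (rule Least_le)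
  have "m \<noteq> 0" using not_generated_0[OF large Fk Fint Fne t(1)] F(3) by metis
  then obtain q where q: "m = Suc q" by (cases m) auto
  have min: "\<not> generated n k q G" if "optimal n k t G" "left_compressed G" for G
  proof -
    have "q < (LEAST m. Q m)" using q unfolding m_def by simp
    then have "\<not> Q q" by (rule not_less_Least)
    then show ?thesis using that unfolding Q_def by blast
  qed
  interpret P: generated_optimal n k t 3 q F
  proof
    show "generated n k (Suc q) F" "Suc q \<le> n" using F(3) \<open>m \<le> n\<close> q by simp_all
    show "\<not> generated n k q F" using min F by blast
  qed (use F(1,2) ntk t(1) in simp_all)
  obtain r a where ra: "Suc q = t + 2 * r" "k = a + t + r" "r * (a + 3) \<le> (t + r - 1) * (a + 1)"
    "1 \<le> q \<longrightarrow> (\<forall>H. optimal n k t H \<longrightarrow> left_compressed H \<longrightarrow> \<not> generated n k q H) \<longrightarrow>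
      r * (a + 3) < (t + r - 1) * (a + 1)"
    by (rule P.generated_optimal_bound) (rule that)
  have mr: "m = t + 2 * r" using ra(1) q by simp
  have "F \<subseteq> AK_family n k t r"
  \<comment> \<open>For \<open>t = 1\<close> the dual has slack 1, too small for the exchange
    argument. But then the bound for \<open>F\<close> alone gives \<open>r = 0\<close>, and every
    member contains the point 1.\<close>
  proof (cases "t = 1")
    case True
    have "r * (a + 3) \<le> r * (a + 1)" using ra(3) True by simp
    then have "r = 0" by (simp add: distrib_left)
    show ?thesis
    proof
      fix A assume A: "A \<in> F"
      then have "A \<in> ksets n k" using Fk by blast
      note Ak = ksetsD(1,2)[OF this]
      have "t \<le> card (A \<inter> A \<inter> {1..m})" using generated_intersection[OF large Fk Fint F(3) A A] .
      then show "A \<in> AK_family n k t r" using Ak \<open>r = 0\<close> mr unfolding AK_family_def by simp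
    qed
  next
    case False
    then have t2: "2 \<le> t" using t by simp
    then have "1 \<le> q" using ra(1) by simp
    then have strict: "r * (a + 3) < (t + r - 1) * (a + 1)" using ra(4) min by blast
    let ?D = "dual n ` F"
    have D: "optimal n (n - k) 3 ?D" by (rule optimal_dual[OF F(1) _ kn]) (simp add: ntk)
    have Dl: "left_compressed ?D" by (rule left_compressed_dual[OF Fk F(2)])
    have Dk: "?D \<subseteq> ksets n (n - k)" "intersecting 3 ?D" using D unfolding optimal_def by auto
    have large': "2 * (n - k) < n + 3" using ntk t2 kn by simp
    \<comment> \<open>Here \<open>m'\<close> is minimal for this particular dual family only, which
      yields the weak inequality; strictness comes from \<open>F\<close>.\<close>
    define m' where "m' = (LEAST m. generated n (n - k) m ?D)"
    have gn: "generated n (n - k) n ?D" using Dk(1) by (rule generated_n)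
    then have gm: "generated n (n - k) m' ?D" unfolding m'_def by (rule LeastI)
    have "m' \<le> n" unfolding m'_def using gn by (rule Least_le)
    have "m' \<noteq> 0" using not_generated_0[OF large' Dk] gm Fne by (metis image_is_empty one_le_numeral)
    then obtain q' where q': "m' = Suc q'" by (cases m') auto
    have min': "\<not> generated n (n - k) q' ?D"
    proof -
      have "q' < (LEAST m. generated n (n - k) m ?D)" using q' unfolding m'_def by simp
      then show ?thesis by (rule not_less_Least)
    qed
    interpret D: generated_optimal n "n - k" 3 t q' ?D
    proof
      show "generated n (n - k) (Suc q') ?D" "Suc q' \<le> n" using gm \<open>m' \<le> n\<close> q' by simp_all
      show "n + 3 = 2 * (n - k) + t" using ntk kn by simp
    qed (use D Dl min' t2 in simp_all)
    obtain r' a' where ra': "Suc q' = 3 + 2 * r'" "n - k = a' + 3 + r'" "r' * (a' + t) \<le> (3 + r' - 1) * (a' + 1)"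
      by (rule D.generated_optimal_bound) (rule that)
    \<comment> \<open>Adding the expressions for \<open>k\<close> and \<open>n - k\<close> shows
      that this inequality is exactly \<open>m + m' \<le> n\<close>.\<close>
    have "r + r' \<le> a + r"
      by (rule exchange_parameters[OF strict ra'(3) refl _ t(1)]) (use ra(2) ra'(2) ntk kn in simp)
    then have "m + m' \<le> n" using mr q' ra(2) ra'(1,2) ntk kn by simp
    then show ?thesis by (rule product_family_le[OF Fk Fint large F(3) gm _ mr t(1)])
  qed
  moreover have "finite (AK_family n k t r)"
    by (rule finite_subset[of _ "ksets n k"]) (auto simp: AK_family_def ksets_def)
  ultimately have "card F \<le> card (AK_family n k t r)" by (intro card_mono)
  also have "\<dots> \<le> AK n k t" using t(2) mr \<open>m \<le> n\<close> by (intro AK_family_le_AK) auto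
  finally show ?thesis using HF by simp
qed


subsection \<open>Union-intersecting families\<close>

text \<open>The map \<open>f\<close> sends the enlarged set back to \<open>A\<close> and fixes the
  others. It is injective into \<open>F\<close> and shrinks sets, so distinct pairs remain distinct
  and the intersection of unions can only grow.\<close>

lemma union_intersecting_insert:
  assumes F: "F \<subseteq> Pow {1..n}" "union_intersecting l F" and A: "A \<in> F" and x: "x \<in> {1..n}" "insert x A \<notin> F"
  shows "union_intersecting l (insert (insert x A) (F - {A}))"
proof -
  define f where "f B = (if B = insert x A then A else B)" for B
  have f: "f B \<in> F" "f B \<subseteq> B" "finite B" if "B \<in> insert (insert x A) (F - {A})" for B
  proof -
    show "f B \<in> F" "f B \<subseteq> B" using that A unfolding f_def by auto
    have "B \<subseteq> {1..n}" using that F(1) A x(1) by blast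
    then show "finite B" by (rule finite_subset) simp
  qed
  have inj: "f B \<noteq> f C" if "B \<in> insert (insert x A) (F - {A})" "C \<in> insert (insert x A) (F - {A})" "B \<noteq> C" for B C
    using that x(2) unfolding f_def by auto
  show ?thesis unfolding union_intersecting_def
  proof (intro ballI impI)
    fix F1 F2 G1 G2
    assume F12: "F1 \<in> insert (insert x A) (F - {A})" "F2 \<in> insert (insert x A) (F - {A})" "F1 \<noteq> F2"
      and G12: "G1 \<in> insert (insert x A) (F - {A})" "G2 \<in> insert (insert x A) (F - {A})" "G1 \<noteq> G2"
    have "l \<le> card ((f F1 \<union> f F2) \<inter> (f G1 \<union> f G2))"
      using F(2) f(1)[OF F12(1)] f(1)[OF F12(2)] f(1)[OF G12(1)] f(1)[OF G12(2)] inj[OF F12] inj[OF G12]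
      unfolding union_intersecting_def by blast
    also have "\<dots> \<le> card ((F1 \<union> F2) \<inter> (G1 \<union> G2))"
    proof (rule card_mono)
      show "finite ((F1 \<union> F2) \<inter> (G1 \<union> G2))" using f(3)[OF F12(1)] f(3)[OF F12(2)] by blast
      show "(f F1 \<union> f F2) \<inter> (f G1 \<union> f G2) \<subseteq> (F1 \<union> F2) \<inter> (G1 \<union> G2)"
        using f(2)[OF F12(1)] f(2)[OF F12(2)] f(2)[OF G12(1)] f(2)[OF G12(2)] by blast
    qed
    finally show "l \<le> card ((F1 \<union> F2) \<inter> (G1 \<union> G2))" .
  qed
qed

text \<open>Each enlargement keeps the number of members and lowers the total of
  \<open>n - card A\<close>, so the process stops at an up-set.\<close>

lemma exists_up_closed:
  assumes "F \<subseteq> Pow {1..n}" "union_intersecting l F"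
  shows "\<exists>G. G \<subseteq> Pow {1..n} \<and> union_intersecting l G \<and> card G = card F \<and>
    (\<forall>A\<in>G. \<forall>x\<in>{1..n}. insert x A \<in> G)"
  using assms
proof (induction "\<Sum>A\<in>F. n - card A" arbitrary: F rule: less_induct)
  case less
  show ?case
  proof (cases "\<forall>A\<in>F. \<forall>x\<in>{1..n}. insert x A \<in> F")
    case True then show ?thesis using less.prems by blast
  next
    case False
    then obtain A x where A: "A \<in> F" "x \<in> {1..n}" "insert x A \<notin> F" by blast
    define G where "G = insert (insert x A) (F - {A})"
    have fF: "finite F" using less.prems(1) by (rule finite_subset) simp
    have xA: "x \<notin> A" using A by (metis insert_absorb)
    have An: "A \<subseteq> {1..n}" "insert x A \<subseteq> {1..n}" using A less.prems(1) by blast+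
    then have fA: "finite A" using finite_subset by blast
    have "card (insert x A) \<le> n" using card_mono[OF _ An(2)] by simp
    then have cA: "card (insert x A) = Suc (card A)" "Suc (card A) \<le> n" using fA xA by simp_all
    have "(\<Sum>A\<in>G. n - card A) = (n - card (insert x A)) + (\<Sum>A\<in>F - {A}. n - card A)"
      unfolding G_def using fF A(3) by simp
    also have "\<dots> < (n - card A) + (\<Sum>A\<in>F - {A}. n - card A)" using cA by simp
    also have "\<dots> = (\<Sum>A\<in>F. n - card A)" using fF A(1) by (simp add: sum.remove)
    finally have lt: "(\<Sum>A\<in>G. n - card A) < (\<Sum>A\<in>F. n - card A)" .
    have "G \<subseteq> Pow {1..n}" using An less.prems(1) unfolding G_def by blast
    moreover have "union_intersecting l G" unfolding G_def by (rule union_intersecting_insert[OF less.prems A])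
    moreover have "card G = card F" unfolding G_def using fF A card_Suc_Diff1[OF fF A(1)] by simp
    ultimately show ?thesis using less.hyps[OF lt] by simp
  qed
qed

section \<open>Levels of an up-closed union-intersecting family\<close>

locale up_closed_union_intersecting =
  fixes n l :: nat and F :: "nat set set"
  assumes sub: "F \<subseteq> Pow {1..n}" and ui: "union_intersecting l F"
    and up: "\<And>A x. A \<in> F \<Longrightarrow> x \<in> {1..n} \<Longrightarrow> insert x A \<in> F"
    and l1: "1 \<le> l" and ln: "l \<le> n"
begin

definition nonminimal :: "nat set set" where "nonminimal = {A \<in> F. \<exists>B\<in>F. B \<subset> A}"

definition level :: "nat set set \<Rightarrow> nat \<Rightarrow> nat set set" where "level G i = {A \<in> G. card A = i}"

lemma finite_F: "finite F" using sub by (rule finite_subset) simp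

lemma subset_n: "A \<in> F \<Longrightarrow> A \<subseteq> {1..n}" using sub by blast

lemma finite_mem: "A \<in> F \<Longrightarrow> finite A" using subset_n finite_subset by blast

lemma nonminimal_F: "A \<in> nonminimal \<Longrightarrow> A \<in> F" by (simp add: nonminimal_def)

lemma level_ksets: "level F i \<subseteq> ksets n i" "level nonminimal i \<subseteq> ksets n i"
proof -
  have "A \<in> ksets n i" if "A \<in> F" "card A = i" for A using subset_n[OF that(1)] that(2) by (rule ksetsI)
  then show "level F i \<subseteq> ksets n i" "level nonminimal i \<subseteq> ksets n i"
    unfolding level_def nonminimal_def by blast+
qed

text \<open>A non-minimal member is the union of two distinct members, itself and one strictly below
  it.\<close>

lemma nonminimal_intersecting:
  assumes "A \<in> nonminimal" "B \<in> nonminimal" shows "l \<le> card (A \<inter> B)"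
proof -
  obtain A' B' where A: "A \<in> F" "A' \<in> F" "A' \<subset> A" and B: "B \<in> F" "B' \<in> F" "B' \<subset> B"
    using assms unfolding nonminimal_def by blast
  have "l \<le> card ((A \<union> A') \<inter> (B \<union> B'))"
    using ui A B unfolding union_intersecting_def by blast
  moreover have "A \<union> A' = A" "B \<union> B' = B" using A B by blast+
  ultimately show ?thesis by simp
qed

lemma insert_nonminimal: "A \<in> F \<Longrightarrow> x \<in> {1..n} \<Longrightarrow> x \<notin> A \<Longrightarrow> insert x A \<in> nonminimal"
  using up unfolding nonminimal_def by blast

lemma exists_missing:
  assumes "A \<subseteq> {1..n}" "card A < n" obtains x where "x \<in> {1..n}" "x \<notin> A"
proof -
  have "\<not> {1..n} \<subseteq> A" using assms card_mono[of A "{1..n}"] finite_subset[OF assms(1)] by auto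
  then show thesis using that by blast
qed

lemma card_Un_level:
  assumes "A \<in> F" "B \<in> F" shows "card (A \<inter> B) + card (A \<union> B) = card A + card B"
  using card_Un_Int[OF finite_mem[OF assms(1)] finite_mem[OF assms(2)]] by simp

text \<open>Adding missing points \<open>x\<close> to \<open>A\<close> and \<open>y\<close> to
  \<open>B\<close> gives non-minimal members, which meet in \<open>l\<close> points. If
  \<open>A \<inter> B\<close> is one short of \<open>l\<close>, two different points outside
  \<open>A \<union> B\<close> add nothing to the intersection; if two short, one common outside
  point adds only one; if three or more short, two additions cannot suffice. The bound on
  \<open>i\<close> provides the outside points.\<close>

lemma level_intersecting:
  assumes i: "2 * i + 3 \<le> n + l" shows "intersecting l (level F i)"
  unfolding cross_intersecting_def
proof (intro ballI)
  fix A B assume "A \<in> level F i" "B \<in> level F i"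
  then have A: "A \<in> F" "card A = i" and B: "B \<in> F" "card B = i" by (auto simp: level_def)
  have i_n: "i < n" using i ln by simp
  have un: "A \<union> B \<subseteq> {1..n}" using subset_n A(1) B(1) by blast
  have ins: "l \<le> card (insert x A \<inter> insert y B)"
    if "x \<in> {1..n}" "x \<notin> A" "y \<in> {1..n}" "y \<notin> B" for x y
    using nonminimal_intersecting insert_nonminimal A(1) B(1) that by blast
  have fin: "finite (A \<inter> B)" using finite_mem[OF A(1)] by blast
  have c: "card (A \<inter> B) + card (A \<union> B) = 2 * i" using card_Un_level[OF A(1) B(1)] A B by simp
  show "l \<le> card (A \<inter> B)"
  proof (rule ccontr)
    assume small: "\<not> l \<le> card (A \<inter> B)"
    consider "l = card (A \<inter> B) + 1" | "l = card (A \<inter> B) + 2" | "card (A \<inter> B) + 3 \<le> l"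
      using small by linarith
    then show False
    proof cases
      case 1
      then have u: "card (A \<union> B) + 2 \<le> n" using c i by linarith
      then obtain x where x: "x \<in> {1..n}" "x \<notin> A \<union> B" using exists_missing[OF un] by auto
      have "insert x (A \<union> B) \<subseteq> {1..n}" using x un by blast
      moreover have "card (insert x (A \<union> B)) < n"
        using u card_insert_le_m1[of "Suc (card (A \<union> B))" "A \<union> B" x] by simp
      ultimately obtain y where y: "y \<in> {1..n}" "y \<notin> insert x (A \<union> B)" by (rule exists_missing)
      have "insert x A \<inter> insert y B = A \<inter> B" using x y by blast
      then show False using ins[of x y] x y small by auto
    next
      case 2
      then have u: "card (A \<union> B) < n" using c i by linarith
      then obtain x where x: "x \<in> {1..n}" "x \<notin> A \<union> B" using exists_missing[OF un] by auto
      have "insert x A \<inter> insert x B = insert x (A \<inter> B)" by blast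
      then show False using ins[of x x] x 2 fin by simp
    next
      case 3
      obtain x where x: "x \<in> {1..n}" "x \<notin> A"
        using exists_missing[OF subset_n[OF A(1)]] A(2) i_n by auto
      obtain y where y: "y \<in> {1..n}" "y \<notin> B"
        using exists_missing[OF subset_n[OF B(1)]] B(2) i_n by auto
      have "card (insert x A \<inter> insert y B) \<le> card (insert x (insert y (A \<inter> B)))"
        using fin by (intro card_mono) auto
      also have "\<dots> \<le> Suc (card (insert y (A \<inter> B)))" by (rule card_insert_le_m1) simp_all
      also have "\<dots> \<le> Suc (Suc (card (A \<inter> B)))" using card_insert_le_m1[of "Suc (card (A \<inter> B))" "A \<inter> B" y] by simp
      finally show False using ins[OF x y] 3 by simp
    qed
  qed
qed

text \<open>As for \<open>level_intersecting\<close>, but \<open>B\<close> is already non-minimal,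
  so only \<open>A\<close> is enlarged and one point outside \<open>A \<union> B\<close> is
  enough.\<close>

lemma level_nonminimal_intersecting:
  assumes ij: "i + j + 2 \<le> n + l" "i < n"
  shows "cross_intersecting l (level F i) (level nonminimal j)"
  unfolding cross_intersecting_def
proof (intro ballI)
  fix A B assume "A \<in> level F i" "B \<in> level nonminimal j"
  then have A: "A \<in> F" "card A = i" and B: "B \<in> nonminimal" "B \<in> F" "card B = j"
    by (auto simp: level_def nonminimal_def)
  have un: "A \<union> B \<subseteq> {1..n}" using subset_n A(1) B(2) by blast
  have ins: "l \<le> card (insert x A \<inter> B)" if "x \<in> {1..n}" "x \<notin> A" for x
    using nonminimal_intersecting[OF insert_nonminimal[OF A(1) that] B(1)] .
  have c: "card (A \<inter> B) + card (A \<union> B) = i + j" using card_Un_level[OF A(1) B(2)] A B by simp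
  have fin: "finite (A \<inter> B)" using finite_mem[OF A(1)] by blast
  show "l \<le> card (A \<inter> B)"
  proof (rule ccontr)
    assume small: "\<not> l \<le> card (A \<inter> B)"
    consider "l = card (A \<inter> B) + 1" | "card (A \<inter> B) + 2 \<le> l" using small by linarith
    then show False
    proof cases
      case 1
      then have u: "card (A \<union> B) < n" using c ij by linarith
      then obtain x where x: "x \<in> {1..n}" "x \<notin> A \<union> B" using exists_missing[OF un] by auto
      have "insert x A \<inter> B = A \<inter> B" using x by blast
      then show False using ins[of x] x small by auto
    next
      case 2
      obtain x where x: "x \<in> {1..n}" "x \<notin> A"
        using exists_missing[OF subset_n[OF A(1)]] A(2) ij by auto
      have "card (insert x A \<inter> B) \<le> card (insert x (A \<inter> B))" using fin by (intro card_mono) auto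
      also have "\<dots> \<le> Suc (card (A \<inter> B))" by (rule card_insert_le_m1) simp_all
      finally show False using ins[OF x] 2 by simp
    qed
  qed
qed

text \<open>The upper shadow, obtained as the shadow of the complements, is no smaller than the
  level itself in the lower half, and in an up-set it consists of non-minimal members.\<close>

lemma level_le_next:
  assumes "2 * i + 1 \<le> n" shows "card (level F i) \<le> card (level nonminimal (Suc i))"
proof -
  let ?c = "\<lambda>A. {1..n} - A"
  have eq: "n - Suc i + 1 = n - i" using assms by simp
  have C: "?c ` level F i \<subseteq> ksets n (n - Suc i + 1)"
  proof
    fix B assume "B \<in> ?c ` level F i"
    then obtain A where "A \<in> ksets n i" "B = ?c A" using level_ksets(1) by blast
    then show "B \<in> ksets n (n - Suc i + 1)" using complement_in_ksets[of A n i] eq by simp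
  qed
  let ?S = "shadow (n - Suc i) (?c ` level F i)"
  have S: "?S \<subseteq> ksets n (n - Suc i)" using C by (rule shadow_subset_ksets)
  have "level F i \<subseteq> Pow {1..n}" using subset_n unfolding level_def by blast
  then have "card (level F i) = card (?c ` level F i)" by (rule card_complements[symmetric])
  also have "\<dots> \<le> card ?S" using C by (rule card_le_card_shadow) (use assms in simp)
  also have "\<dots> = card (?c ` ?S)" by (rule card_complements[symmetric]) (use S ksetsD(1) in blast)
  also have "\<dots> \<le> card (level nonminimal (Suc i))"
  proof (rule card_mono)
    show "finite (level nonminimal (Suc i))" using level_ksets(2) by (rule finite_subset) simp
    show "?c ` ?S \<subseteq> level nonminimal (Suc i)"
    proof
      fix D assume "D \<in> ?c ` ?S"
      then obtain B where B: "B \<in> ?S" "D = ?c B" by blast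
      then have "B \<in> ksets n (n - Suc i)" using S by blast
      then have "D \<in> ksets n (Suc i)" using complement_in_ksets[of B n "n - Suc i"] B(2) assms by simp
      note D = ksetsD[OF this]
      obtain A where A: "A \<in> F" "card A = i" "B \<subseteq> ?c A" using B(1) unfolding shadow_def level_def by blast
      have "A \<subseteq> D" using A(3) B(2) subset_n[OF A(1)] by blast
      moreover have "A \<noteq> D" using A(2) D(2) by auto
      ultimately obtain x where x: "x \<in> D" "x \<notin> A" by blast
      have "insert x A = D"
        using card_subset_eq[OF D(3), of "insert x A"] x \<open>A \<subseteq> D\<close> A(2) D(2) finite_mem[OF A(1)] by simp
      then have "D \<in> nonminimal" using insert_nonminimal[OF A(1), of x] x D(1) by blast
      then show "D \<in> level nonminimal (Suc i)" using D(2) unfolding level_def by blast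
    qed
  qed
  finally show ?thesis .
qed

lemma cross_intersecting_mono: "cross_intersecting t G H \<Longrightarrow> s \<le> t \<Longrightarrow> cross_intersecting s G H"
  unfolding cross_intersecting_def using order_trans by blast

text \<open>For \<open>l \<ge> 2\<close> this is \<open>cross_bound\<close> with
  \<open>u = l - 2\<close>, since \<open>i + j = n + (l - 2)\<close>. For \<open>l = 1\<close> that
  would be negative, so level \<open>i\<close> is first lifted to the non-minimal sets of size
  \<open>i + 1\<close>, and \<open>u = 0\<close> fits.\<close>

lemma level_pair:
  assumes ij: "i < j" "i + j + 2 = n + l"
  shows "card (level F i) + card (level nonminimal j) \<le> n choose j"
proof (cases "l = 1")
  case False
  show ?thesis
  proof (rule cross_bound[OF level_ksets])
    show "intersecting l (level F i)" using ij by (intro level_intersecting) simp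
    have "cross_intersecting l (level F i) (level nonminimal j)"
      using ij ln by (intro level_nonminimal_intersecting) simp_all
    then show "cross_intersecting (Suc (l - 2)) (level F i) (level nonminimal j)"
      by (rule cross_intersecting_mono) (use False l1 in simp)
  qed (use ij l1 False in simp_all)
next
  case True
  have 1: "intersecting 1 nonminimal" "cross_intersecting (Suc 0) nonminimal nonminimal"
    using nonminimal_intersecting True by (auto simp: cross_intersecting_def)
  have "card (level F i) \<le> card (level nonminimal (Suc i))" using ij True by (intro level_le_next) simp
  moreover have "card (level nonminimal (Suc i)) + card (level nonminimal j) \<le> n choose j"
  proof (rule cross_bound[OF level_ksets(2) level_ksets(2)])
    show "intersecting 1 (level nonminimal (Suc i))"
      using 1(1) unfolding cross_intersecting_def level_def by blast
    show "cross_intersecting (Suc 0) (level nonminimal (Suc i)) (level nonminimal j)"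
      using 1(2) unfolding cross_intersecting_def level_def by blast
  qed (use ij True in simp_all)
  ultimately show ?thesis by simp
qed

text \<open>Levels are paired outwards from the middle, \<open>a - 1\<close> with
  \<open>b + 1\<close> first, each pair keeping the sum \<open>n + l - 2\<close>.\<close>

lemma level_sums:
  assumes "a \<le> b" "a + b + 2 = n + l"
  shows "(\<Sum>i<a. card (level F i)) + (\<Sum>j=Suc b..n. card (level nonminimal j)) \<le> (\<Sum>j=Suc b..n. n choose j)"
  using assms
proof (induction a arbitrary: b)
  case 0
  have "(\<Sum>j=Suc b..n. card (level nonminimal j)) \<le> (\<Sum>j=Suc b..n. n choose j)"
    by (intro sum_mono card_ksets_le level_ksets)
  then show ?case by simp
next
  case (Suc a)
  have IH: "(\<Sum>i<a. card (level F i)) + (\<Sum>j=Suc (Suc b)..n. card (level nonminimal j)) \<le> (\<Sum>j=Suc (Suc b)..n. n choose j)"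
    using Suc.prems by (intro Suc.IH) simp_all
  show ?case
  proof (cases "Suc b \<le> n")
    case True
    have "card (level F a) + card (level nonminimal (Suc b)) \<le> n choose Suc b"
      using Suc.prems by (intro level_pair) simp_all
    then show ?thesis using IH True by (simp add: sum.atLeast_Suc_atMost[of "Suc b" n])
  next
    case False
    \<comment> \<open>The partner level would lie above \<open>n\<close>. Then \<open>a < l\<close>,
      and an \<open>l\<close>-intersecting family of sets with fewer than \<open>l\<close> points is
      empty.\<close>
    have "intersecting l (level F a)" using Suc.prems by (intro level_intersecting) simp
    moreover have "a < l" using Suc.prems False by simp
    ultimately have "level F a = {}" unfolding cross_intersecting_def level_def by fastforce
    then show ?thesis using IH False by simp
  qed
qed

lemma card_levels:
  assumes "G \<subseteq> F" "finite I" shows "card {A \<in> G. card A \<in> I} = (\<Sum>i\<in>I. card (level G i))"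
proof -
  have "finite G" using assms(1) finite_F by (rule finite_subset)
  have "{A \<in> G. card A \<in> I} = (\<Union>i\<in>I. level G i)" unfolding level_def by blast
  also have "card \<dots> = (\<Sum>i\<in>I. card (level G i))"
    by (rule card_UN_disjoint) (use assms \<open>finite G\<close> in \<open>auto simp: level_def\<close>)
  finally show ?thesis .
qed

text \<open>The pairing of levels takes care of the non-minimal members above \<open>b\<close>,
  collected in \<open>U\<close>. The rest, \<open>M\<close>, is an antichain: a member strictly
  above another is non-minimal, hence of size \<open>b\<close>, and the one below would be too
  small.\<close>

lemma card_outer_levels:
  assumes ab: "a \<le> b" "a + b + 2 = n + l" "n \<le> 2 * b + 1" "b \<le> n"
  shows "card {A \<in> F. card A < a} + card {A \<in> F. b \<le> card A} \<le> (\<Sum>j=b..n. n choose j)"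
proof -
  have card_n: "card A \<le> n" if "A \<in> F" for A using card_mono[OF _ subset_n[OF that]] by simp
  have nF: "nonminimal \<subseteq> F" using nonminimal_F by blast
  define M where "M = level nonminimal b \<union> {A \<in> F - nonminimal. b \<le> card A}"
  define U where "U = {A \<in> nonminimal. card A \<in> {Suc b..n}}"
  have "card M \<le> n choose b"
  proof (rule card_antichain_le[OF _ _ _ ab(3)])
    show "M \<subseteq> Pow {1..n}" using sub nF unfolding M_def level_def by blast
    show "b \<le> card A" if "A \<in> M" for A using that unfolding M_def level_def by auto
    show "A = B" if AB: "A \<in> M" "B \<in> M" "A \<subseteq> B" for A B
    proof (rule ccontr)
      assume "A \<noteq> B"
      then have lt: "A \<subset> B" using AB(3) by blast
      have F: "A \<in> F" "B \<in> F" using AB nF unfolding M_def level_def by blast+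
      then have "B \<in> nonminimal" using lt unfolding nonminimal_def by blast
      then have "card B = b" using AB(2) unfolding M_def level_def by blast
      moreover have "b \<le> card A" using AB(1) unfolding M_def level_def by auto
      ultimately show False using psubset_card_mono[OF finite_mem[OF F(2)] lt] by simp
    qed
  qed
  moreover have "{A \<in> F. b \<le> card A} = M \<union> U"
  proof (intro equalityI subsetI)
    fix A assume A: "A \<in> {A \<in> F. b \<le> card A}"
    then have "card A = b \<or> card A \<in> {Suc b..n}" using card_n[of A] by auto
    then show "A \<in> M \<union> U" using A unfolding M_def U_def level_def by blast
  next
    fix A assume "A \<in> M \<union> U"
    then show "A \<in> {A \<in> F. b \<le> card A}" using nF unfolding M_def U_def level_def by auto
  qed
  then have "card {A \<in> F. b \<le> card A} \<le> card M + card U" by (simp add: card_Un_le)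
  moreover have "card U = (\<Sum>j=Suc b..n. card (level nonminimal j))"
    unfolding U_def by (rule card_levels[OF nF]) simp
  moreover have "card {A \<in> F. card A < a} = (\<Sum>i<a. card (level F i))"
    using card_levels[of F "{..<a}"] by simp
  ultimately show ?thesis
    using level_sums[OF ab(1,2)] ab(4) by (simp add: sum.atLeast_Suc_atMost[of b n])
qed

lemma card_even_bound:
  assumes "2 * q + 2 = n + l" shows "card F \<le> (\<Sum>j=q..n. n choose j)"
proof -
  have "F = {A \<in> F. card A < q} \<union> {A \<in> F. q \<le> card A}" by auto
  then have "card F \<le> card {A \<in> F. card A < q} + card {A \<in> F. q \<le> card A}" by (metis card_Un_le)
  also have "\<dots> \<le> (\<Sum>j=q..n. n choose j)"
    using assms l1 ln by (intro card_outer_levels) simp_all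
  finally show ?thesis .
qed

lemma card_odd_bound:
  assumes "2 * k + 3 = n + l" shows "card F \<le> AK n k l + (\<Sum>j=Suc k..n. n choose j)"
proof -
  have "F = {A \<in> F. card A < k} \<union> {A \<in> F. Suc k \<le> card A} \<union> level F k" unfolding level_def by auto
  then have "card F \<le> card {A \<in> F. card A < k} + card {A \<in> F. Suc k \<le> card A} + card (level F k)"
    by (metis (no_types, lifting) add_le_mono1 card_Un_le order_trans)
  moreover have "card {A \<in> F. card A < k} + card {A \<in> F. Suc k \<le> card A} \<le> (\<Sum>j=Suc k..n. n choose j)"
    using assms l1 ln by (intro card_outer_levels) simp_all
  moreover have "card (level F k) \<le> AK n k l"
    using assms l1 ln by (intro complete_intersection[OF level_ksets(1) level_intersecting]) simp_all
  ultimately show ?thesis by linarith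
qed

end

section \<open>Families attaining the bounds\<close>

lemma card_large_sets:
  "card {A. A \<subseteq> {1..n} \<and> q \<le> card A} = (\<Sum>i=q..n. n choose i)"
proof -
  have "A \<subseteq> {1..n} \<Longrightarrow> card A \<le> n" for A using card_mono[of "{1..n}" A] by simp
  then have "{A. A \<subseteq> {1..n} \<and> q \<le> card A} = (\<Union>i\<in>{q..n}. ksets n i)" unfolding ksets_def by auto
  also have "card \<dots> = (\<Sum>i=q..n. card (ksets n i))"
  proof (rule card_UN_disjoint)
    show "\<forall>i\<in>{q..n}. \<forall>j\<in>{q..n}. i \<noteq> j \<longrightarrow> ksets n i \<inter> ksets n j = {}"
      unfolding ksets_def by blast
  qed simp_all
  finally show ?thesis by (simp add: card_ksets)
qed

lemma card_Un_distinct: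
  assumes "finite A" "finite B" "q \<le> card A" "q \<le> card B" "A \<noteq> B" shows "Suc q \<le> card (A \<union> B)"
proof (rule ccontr)
  assume "\<not> Suc q \<le> card (A \<union> B)"
  then have "A = A \<union> B" "B = A \<union> B"
    using assms card_seteq[of "A \<union> B" A] card_seteq[of "A \<union> B" B] by auto
  then show False using assms(5) by simp
qed

lemma card_Int_ge:
  assumes "X \<subseteq> {1..n}" "Y \<subseteq> {1..n}" shows "card X + card Y \<le> n + card (X \<inter> Y)"
proof -
  have "finite X" "finite Y" using assms finite_subset by blast+
  moreover have "card (X \<union> Y) \<le> n" using assms card_mono[of "{1..n}" "X \<union> Y"] by simp
  ultimately show ?thesis using card_Un_Int[of X Y] by simp
qed

text \<open>Unions of two distinct members have at least \<open>q + 1\<close> points, and two such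
  unions share at least \<open>2 * (q + 1) - n = l\<close> of them.\<close>

lemma union_intersecting_large_sets:
  assumes "2 * q + 2 = n + l" shows "union_intersecting l {A. A \<subseteq> {1..n} \<and> q \<le> card A}"
  unfolding union_intersecting_def
proof (intro ballI impI)
  let ?S = "{A. A \<subseteq> {1..n} \<and> q \<le> card A}"
  have un: "Suc q \<le> card (A \<union> B)" "A \<union> B \<subseteq> {1..n}" if "A \<in> ?S" "B \<in> ?S" "A \<noteq> B" for A B
    using that finite_subset[of _ "{1..n}"] by (auto intro!: card_Un_distinct)
  fix F1 F2 G1 G2 assume "F1 \<in> ?S" "F2 \<in> ?S" "G1 \<in> ?S" "G2 \<in> ?S" "F1 \<noteq> F2" "G1 \<noteq> G2"
  then show "l \<le> card ((F1 \<union> F2) \<inter> (G1 \<union> G2))"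
    using un[of F1 F2] un[of G1 G2] card_Int_ge[of "F1 \<union> F2" n "G1 \<union> G2"] assms by linarith
qed

lemma AK_family_intersecting:
  assumes "A \<in> AK_family n k l i" "B \<in> AK_family n k l i" shows "l \<le> card (A \<inter> B)"
proof -
  let ?m = "l + 2 * i"
  have A: "A \<subseteq> {1..n}" "l + i \<le> card (A \<inter> {1..?m})" and B: "l + i \<le> card (B \<inter> {1..?m})"
    using assms by (auto simp: AK_family_def)
  have "card (A \<inter> {1..?m}) + card (B \<inter> {1..?m}) \<le> ?m + card ((A \<inter> {1..?m}) \<inter> (B \<inter> {1..?m}))"
    by (rule card_Int_ge) blast+
  moreover have "finite A" using A(1) by (rule finite_subset) simp
  then have "card ((A \<inter> {1..?m}) \<inter> (B \<inter> {1..?m})) \<le> card (A \<inter> B)" by (intro card_mono) auto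
  ultimately show ?thesis using A B by linarith
qed

text \<open>All unions have at least \<open>k + 1\<close> points. If one of the two has
  \<open>k + 2\<close>, counting gives \<open>2 * k + 3 - n = l\<close> common points. Otherwise
  neither is a union of two large sets, so each contains a member of the \<open>AK_family\<close>,
  and those two members already share \<open>l\<close> points.\<close>

lemma union_intersecting_AK_large_sets:
  assumes k: "2 * k + 3 = n + l"
  shows "union_intersecting l (AK_family n k l i \<union> {A. A \<subseteq> {1..n} \<and> Suc k \<le> card A})"
  unfolding union_intersecting_def
proof (intro ballI impI)
  let ?E = "AK_family n k l i" and ?L = "{A. A \<subseteq> {1..n} \<and> Suc k \<le> card A}"
  have mem: "A \<subseteq> {1..n}" "k \<le> card A" "finite A" if "A \<in> ?E \<union> ?L" for A
  proof -
    show "A \<subseteq> {1..n}" using that unfolding AK_family_def by blast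
    then show "finite A" by (rule finite_subset) simp
    show "k \<le> card A" using that unfolding AK_family_def by auto
  qed
  have un: "A \<union> B \<subseteq> {1..n}" "Suc k \<le> card (A \<union> B)" "Suc (Suc k) \<le> card (A \<union> B) \<or> (\<exists>C\<in>?E. C \<subseteq> A \<union> B)"
    if AB: "A \<in> ?E \<union> ?L" "B \<in> ?E \<union> ?L" "A \<noteq> B" for A B
  proof -
    show "A \<union> B \<subseteq> {1..n}" using mem(1) AB(1,2) by blast
    show "Suc k \<le> card (A \<union> B)"
      by (rule card_Un_distinct) (use mem[OF AB(1)] mem[OF AB(2)] AB(3) in simp_all)
    show "Suc (Suc k) \<le> card (A \<union> B) \<or> (\<exists>C\<in>?E. C \<subseteq> A \<union> B)"
    proof (cases "A \<in> ?E \<or> B \<in> ?E")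
      case True then show ?thesis by blast
    next
      case False
      then have "Suc k \<le> card A" "Suc k \<le> card B" using AB by auto
      then have "Suc (Suc k) \<le> card (A \<union> B)"
        by (rule card_Un_distinct[OF mem(3)[OF AB(1)] mem(3)[OF AB(2)] _ _ AB(3)])
      then show ?thesis ..
    qed
  qed
  fix F1 F2 G1 G2
  assume *: "F1 \<in> ?E \<union> ?L" "F2 \<in> ?E \<union> ?L" "G1 \<in> ?E \<union> ?L" "G2 \<in> ?E \<union> ?L" "F1 \<noteq> F2" "G1 \<noteq> G2"
  note f = un[OF *(1,2,5)] and g = un[OF *(3,4,6)]
  have c: "card (F1 \<union> F2) + card (G1 \<union> G2) \<le> n + card ((F1 \<union> F2) \<inter> (G1 \<union> G2))"
    by (rule card_Int_ge[OF f(1) g(1)])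
  show "l \<le> card ((F1 \<union> F2) \<inter> (G1 \<union> G2))"
  proof (cases "Suc (Suc k) \<le> card (F1 \<union> F2) \<or> Suc (Suc k) \<le> card (G1 \<union> G2)")
    case True then show ?thesis using c f(2) g(2) k by linarith
  next
    case False
    then obtain C D where C: "C \<in> ?E" "C \<subseteq> F1 \<union> F2" and D: "D \<in> ?E" "D \<subseteq> G1 \<union> G2" using f(3) g(3) by blast
    have "l \<le> card (C \<inter> D)" using AK_family_intersecting[OF C(1) D(1)] .
    also have "\<dots> \<le> card ((F1 \<union> F2) \<inter> (G1 \<union> G2))"
      using C(2) D(2) mem(3)[OF *(1)] mem(3)[OF *(2)] by (intro card_mono) auto
    finally show ?thesis .
  qed
qed

lemma card_AK_large_sets:
  "card (AK_family n k l i \<union> {A. A \<subseteq> {1..n} \<and> Suc k \<le> card A}) =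
    card (AK_family n k l i) + (\<Sum>i=Suc k..n. n choose i)"
proof -
  have fin: "finite (AK_family n k l i)" "finite {A. A \<subseteq> {1..n} \<and> Suc k \<le> card A}"
    by (rule finite_subset[of _ "Pow {1..n}"]; auto simp: AK_family_def)+
  have "AK_family n k l i \<inter> {A. A \<subseteq> {1..n} \<and> Suc k \<le> card A} = {}"
    by (auto simp: AK_family_def)
  then show ?thesis using fin card_large_sets[of n "Suc k"] by (simp add: card_Un_disjoint)
qed

lemma AK_attained: "\<exists>i. AK n k l = card (AK_family n k l i)"
proof -
  have "AK n k l \<in> (\<lambda>i. card (AK_family n k l i)) ` {0..(n - l) div 2}"
    unfolding AK_def by (rule Max_in) auto
  then show ?thesis by blast
qed

section \<open>The bounds and their sharpness for each parity\<close>

lemma even_case: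
  assumes "2 * q + 2 = n + l" "1 \<le> l" "l \<le> n"
  shows "(\<forall>F. F \<subseteq> Pow {1..n} \<and> union_intersecting l F \<longrightarrow> card F \<le> (\<Sum>i=q..n. n choose i)) \<and>
    (\<exists>F. F \<subseteq> Pow {1..n} \<and> union_intersecting l F \<and> card F = (\<Sum>i=q..n. n choose i))"
proof (intro conjI allI impI)
  fix F assume F: "F \<subseteq> Pow {1..n} \<and> union_intersecting l F"
  obtain G where G: "G \<subseteq> Pow {1..n}" "union_intersecting l G" "card G = card F"
    "\<forall>A\<in>G. \<forall>x\<in>{1..n}. insert x A \<in> G"
    using exists_up_closed[OF conjunct1[OF F] conjunct2[OF F]] by auto
  interpret up_closed_union_intersecting n l G
    by unfold_locales (fact G(1,2) G(4)[rule_format] assms(2,3))+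
  show "card F \<le> (\<Sum>i=q..n. n choose i)" using card_even_bound[OF assms(1)] G(3) by simp
next
  show "\<exists>F. F \<subseteq> Pow {1..n} \<and> union_intersecting l F \<and> card F = (\<Sum>i=q..n. n choose i)"
    using union_intersecting_large_sets[OF assms(1)] card_large_sets[of n q]
    by (intro exI[of _ "{A. A \<subseteq> {1..n} \<and> q \<le> card A}"] conjI) auto
qed

lemma odd_case:
  assumes "2 * k + 3 = n + l" "1 \<le> l" "l \<le> n"
  shows "(\<forall>F. F \<subseteq> Pow {1..n} \<and> union_intersecting l F \<longrightarrow> card F \<le> AK n k l + (\<Sum>i=Suc k..n. n choose i)) \<and>
    (\<exists>F. F \<subseteq> Pow {1..n} \<and> union_intersecting l F \<and> card F = AK n k l + (\<Sum>i=Suc k..n. n choose i))"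
proof (intro conjI allI impI)
  fix F assume F: "F \<subseteq> Pow {1..n} \<and> union_intersecting l F"
  obtain G where G: "G \<subseteq> Pow {1..n}" "union_intersecting l G" "card G = card F"
    "\<forall>A\<in>G. \<forall>x\<in>{1..n}. insert x A \<in> G"
    using exists_up_closed[OF conjunct1[OF F] conjunct2[OF F]] by auto
  interpret up_closed_union_intersecting n l G
    by unfold_locales (fact G(1,2) G(4)[rule_format] assms(2,3))+
  show "card F \<le> AK n k l + (\<Sum>i=Suc k..n. n choose i)" using card_odd_bound[OF assms(1)] G(3) by simp
next
  obtain i where i: "AK n k l = card (AK_family n k l i)" using AK_attained by blast
  have s: "AK_family n k l i \<union> {A. A \<subseteq> {1..n} \<and> Suc k \<le> card A} \<subseteq> Pow {1..n}"
    unfolding AK_family_def by blast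
  show "\<exists>F. F \<subseteq> Pow {1..n} \<and> union_intersecting l F \<and> card F = AK n k l + (\<Sum>i=Suc k..n. n choose i)"
    unfolding i using s union_intersecting_AK_large_sets[OF assms(1)] card_AK_large_sets
    by (intro exI conjI)
qed

theorem theorem2p1:
  fixes n l :: nat
  assumes "3 \<le> n" and "1 \<le> l" and "l \<le> n"
  shows "(even (n + l) \<longrightarrow>
            (\<forall>\<F>. \<F> \<subseteq> Pow {1..n} \<and> union_intersecting l \<F> \<longrightarrow>
               card \<F> \<le> (\<Sum>i = (n + l) div 2 - 1..n. n choose i)) \<and>
            (\<exists>\<F>. \<F> \<subseteq> Pow {1..n} \<and> union_intersecting l \<F> \<and>
               card \<F> = (\<Sum>i = (n + l) div 2 - 1..n. n choose i))) \<and>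
         (odd (n + l) \<longrightarrow>
            (\<forall>\<F>. \<F> \<subseteq> Pow {1..n} \<and> union_intersecting l \<F> \<longrightarrow>
               card \<F> \<le> AK n ((n + l - 3) div 2) l + (\<Sum>i = (n + l - 1) div 2..n. n choose i)) \<and>
            (\<exists>\<F>. \<F> \<subseteq> Pow {1..n} \<and> union_intersecting l \<F> \<and>
               card \<F> = AK n ((n + l - 3) div 2) l + (\<Sum>i = (n + l - 1) div 2..n. n choose i)))"
proof (intro conjI[of "_ \<longrightarrow> _"] impI)
  assume "even (n + l)"
  then obtain m where "n + l = 2 * m" by (rule evenE)
  then show "(\<forall>\<F>. \<F> \<subseteq> Pow {1..n} \<and> union_intersecting l \<F> \<longrightarrow>
               card \<F> \<le> (\<Sum>i = (n + l) div 2 - 1..n. n choose i)) \<and>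
            (\<exists>\<F>. \<F> \<subseteq> Pow {1..n} \<and> union_intersecting l \<F> \<and>
               card \<F> = (\<Sum>i = (n + l) div 2 - 1..n. n choose i))"
    using assms by (intro even_case) auto
next
  assume "odd (n + l)"
  then obtain m where m: "n + l = 2 * m + 1" by (rule oddE)
  \<comment> \<open>The size \<open>k\<close> of the unpaired middle level is \<open>m - 1\<close>;
    with \<open>3 \<le> n\<close> no subtraction is truncated.\<close>
  then have "(n + l - 3) div 2 = m - 1" "(n + l - 1) div 2 = Suc (m - 1)" "2 * (m - 1) + 3 = n + l"
    using assms by auto
  then show "(\<forall>\<F>. \<F> \<subseteq> Pow {1..n} \<and> union_intersecting l \<F> \<longrightarrow>
               card \<F> \<le> AK n ((n + l - 3) div 2) l + (\<Sum>i = (n + l - 1) div 2..n. n choose i)) \<and>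
            (\<exists>\<F>. \<F> \<subseteq> Pow {1..n} \<and> union_intersecting l \<F> \<and>
               card \<F> = AK n ((n + l - 3) div 2) l + (\<Sum>i = (n + l - 1) div 2..n. n choose i))"
    using odd_case[of "m - 1" n l] assms(2,3) by simp
qed

end
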